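(* Let $p,q,r$ be positive real numbers. Then every solution $\{y_n\}_{n\ge -1}$ of $$y_{n+1}=\frac{r+p\,y_n+y_{n-1}}{q\,y_n+y_{n-1}},\quad n=0,1,2,\dots,\qquad y_{-1},y_0\in(0,\infty),$$ converges to the unique equilibrium or to a prime period-two solution.
   Context: A solution is a sequence $\{y_n\}_{n\ge -1}$ with initial values in $(0,\infty)$ satisfying the recursion. An equilibrium is a number $\overline{y}\in(0,\infty)$ such that the constant sequence $y_n=\overline{y}$ is a solution; the unique equilibrium is $\overline{y}=\frac{p+1+\sqrt{(p+1)^2+4r(q+1)}}{2(q+1)}$. A prime period-two solution is a solution $\{p_n\}_{n\ge -1}$ with $p_{n+2}=p_n$ for all $n\ge -1$ and $p_{-1}\neq p_0$. A solution $\{y_n\}$ converges to a prime period-two solution $\{p_n\}$ if $y_n-p_n\to 0$ as $n\to\infty$. *)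

theory Defs
  imports Complex_Main
begin

text \<open>
  Sequences \<open>{y_n}\<close> with \<open>n \<ge> -1\<close> are functions on \<^typ>\<open>nat\<close> with the index shifted by one:
  \<open>y 0\<close> stands for \<open>y_{-1}\<close>, \<open>y 1\<close> for \<open>y_0\<close>, and in general \<open>y (n + 1)\<close> for \<open>y_n\<close>.
\<close>

definition is_solution :: "real \<Rightarrow> real \<Rightarrow> real \<Rightarrow> (nat \<Rightarrow> real) \<Rightarrow> bool" where
  "is_solution p q r y \<longleftrightarrow>
     y 0 > 0 \<and> y 1 > 0 \<and>
     (\<forall>n. y (n + 2) = (r + p * y (n + 1) + y n) / (q * y (n + 1) + y n))"

definition is_equilibrium :: "real \<Rightarrow> real \<Rightarrow> real \<Rightarrow> real \<Rightarrow> bool" where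
  "is_equilibrium p q r e \<longleftrightarrow> e > 0 \<and> is_solution p q r (\<lambda>n. e)"

text \<open>
  For positive parameters the following description is proper, and it has the expected closed
  form; see \<open>ex1_equilibrium\<close> and \<open>equilibrium_eq\<close> below.
\<close>

definition equilibrium :: "real \<Rightarrow> real \<Rightarrow> real \<Rightarrow> real" where
  "equilibrium p q r = (THE e. is_equilibrium p q r e)"

definition is_prime_period_two_solution ::
    "real \<Rightarrow> real \<Rightarrow> real \<Rightarrow> (nat \<Rightarrow> real) \<Rightarrow> bool" where
  "is_prime_period_two_solution p q r u \<longleftrightarrow>
     is_solution p q r u \<and> (\<forall>n. u (n + 2) = u n) \<and> u 0 \<noteq> u 1"

lemma is_equilibrium_iff:
  assumes "p > 0" "q > 0" "r > 0"
  shows "is_equilibrium p q r e \<longleftrightarrow>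
           e = (p + 1 + sqrt ((p + 1)\<^sup>2 + 4 * r * (q + 1))) / (2 * (q + 1))"
proof -
  define s where "s = sqrt ((p + 1)\<^sup>2 + 4 * r * (q + 1))"
  have pos: "4 * r * (q + 1) > 0" using assms by simp
  have s2: "s\<^sup>2 = (p + 1)\<^sup>2 + 4 * r * (q + 1)"
    unfolding s_def using pos by (intro real_sqrt_pow2) (simp add: add_nonneg_nonneg)
  have s_gt: "s > p + 1"
    unfolding s_def using pos by (intro real_less_rsqrt) simp
  have fixpoint: "e = (r + p * e + e) / (q * e + e) \<longleftrightarrow> 2 * (q + 1) * e = p + 1 + s" if "e > 0"
  proof -
    have d: "q * e + e > 0" using that assms by (simp add: add_pos_pos)
    have "e = (r + p * e + e) / (q * e + e) \<longleftrightarrow> e * (q * e + e) = r + p * e + e"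
      using d by (simp add: eq_divide_eq)
    also have "\<dots> \<longleftrightarrow> 4 * (q + 1) * (e * (q * e + e)) = 4 * (q + 1) * (r + p * e + e)"
      using assms by simp
    also have "\<dots> \<longleftrightarrow> (2 * (q + 1) * e - (p + 1))\<^sup>2 = s\<^sup>2"
      unfolding s2 by (simp add: power2_eq_square algebra_simps)
    also have "\<dots> \<longleftrightarrow> 2 * (q + 1) * e = p + 1 + s"
    proof -
      have "2 * (q + 1) * e > 0" using that assms by simp
      then have "2 * (q + 1) * e - (p + 1) \<noteq> - s" using s_gt by linarith
      then show ?thesis unfolding power2_eq_iff by linarith
    qed
    finally show ?thesis .
  qed
  have closed: "2 * (q + 1) * e = p + 1 + s \<longleftrightarrow> e = (p + 1 + s) / (2 * (q + 1))"
    using assms by (simp add: eq_divide_eq mult.commute)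
  have "(p + 1 + s) / (2 * (q + 1)) > 0" using assms s_gt by simp
  then show ?thesis
    using fixpoint closed unfolding is_equilibrium_def is_solution_def s_def by auto
qed

lemma ex1_equilibrium:
  assumes "p > 0" "q > 0" "r > 0"
  shows "\<exists>!e. is_equilibrium p q r e"
  using is_equilibrium_iff[OF assms] by simp

lemma equilibrium_eq:
  assumes "p > 0" "q > 0" "r > 0"
  shows "equilibrium p q r = (p + 1 + sqrt ((p + 1)\<^sup>2 + 4 * r * (q + 1))) / (2 * (q + 1))"
  unfolding equilibrium_def by (rule the_equality) (simp_all only: is_equilibrium_iff[OF assms])

end

theory Submission
  imports Defs "HOL-Analysis.Analysis"
begin

text \<open>
  The right-hand side of the recursion is \<open>f (y n) (y (n - 1))\<close> with
  \<open>f u v = (r + p * u + v) / (q * u + v)\<close>. Everything is read off from the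
  \<open>\<omega>\<close>-limit set of a solution, a compact set of pairs that is invariant forward and backward,
  and from its extreme values \<open>m \<le> M\<close>. Both are values of \<open>f\<close> at points of the limit set, so
  wherever \<open>f\<close> is monotone they are bounded by values of \<open>f\<close> at corners of
  \<open>{m..M} \<times> {m..M}\<close>. The map is monotone in each argument on either side of a threshold, and
  \<open>f\<close> takes the constant value \<open>1\<close> or \<open>p / q\<close> on the threshold lines. Hence it is known
  which monotonicity holds where a limit value is attained.

  For \<open>p \<le> q\<close> the corner inequalities (\<open>box_collapse_antimono_antimono\<close>,
  \<open>box_collapse_mixed_antimono\<close>) give \<open>m = M\<close>, unless all limit values lie between
  \<open>r / (q - p)\<close> and \<open>1\<close>. On that interval \<open>f\<close> decreases in \<open>u\<close> and increases in \<open>v\<close>, and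
  the terms of even and of odd index are eventually monotone
  (\<open>even_odd_subsequences_converge\<close>). This is where solutions of period two appear.

  For \<open>p > q\<close> the corner inequalities leave only the case that \<open>f\<close> increases in \<open>u\<close> and
  decreases in \<open>v\<close> on the limit set. There the corner inequalities may have solutions
  \<open>m < M\<close>, and solutions may spiral slowly around the equilibrium: for small \<open>q\<close> and large
  \<open>p\<close> and \<open>r\<close> the recursion is close to Lyness' recursion
  \<open>x (n + 1) = (r + p * x n) / x (n - 1)\<close>, all of whose solutions are confined
  to level curves of an invariant. Therefore the logarithm of Lyness' invariant is deformed
  into a strict Lyapunov function (\<open>Lyapunov_function_if_key_inequality\<close>). Its decrease
  amounts to a polynomial inequality (\<open>key_polynomial\<close>), and LaSalle's principle
  (\<open>limit_pairs_Lyapunov\<close>) then reduces the limit set to the equilibrium.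
\<close>

section \<open>Limit sets of bounded second-order recursions\<close>

text \<open>
  The \<open>\<omega>\<close>-limit set, in the phase plane of pairs of consecutive terms. Pairs are needed
  because a second-order recursion acts on them and not on single values. The selector \<open>s\<close>
  need not be monotone, which makes shifting it by one harmless.
\<close>

definition limit_pairs :: "(nat \<Rightarrow> real) \<Rightarrow> (real \<times> real) set" where
  "limit_pairs y =
     {l. \<exists>s. filterlim s at_top sequentially \<and> (\<lambda>k. (y (s k), y (Suc (s k)))) \<longlonglongrightarrow> l}"

text \<open>
  This description makes it evident that the limit set is closed, which the definition
  through sequences does not.
\<close>

lemma limit_pairs_eq_Inter_closure:
  "limit_pairs y = (\<Inter>N. closure ((\<lambda>n. (y n, y (Suc n))) ` {N..}))"
proof (intro equalityI subsetI INT_I)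
  fix l N assume "l \<in> limit_pairs y"
  then obtain s where s: "filterlim s at_top sequentially"
    and l: "(\<lambda>k. (y (s k), y (Suc (s k)))) \<longlonglongrightarrow> l"
    unfolding limit_pairs_def by blast
  have "eventually (\<lambda>k. N \<le> s k) sequentially"
    using s by (simp add: filterlim_at_top)
  then have "eventually (\<lambda>k. (y (s k), y (Suc (s k))) \<in> closure ((\<lambda>n. (y n, y (Suc n))) ` {N..})) sequentially"
    by eventually_elim (rule subsetD[OF closure_subset], auto)
  then show "l \<in> closure ((\<lambda>n. (y n, y (Suc n))) ` {N..})"
    using Lim_in_closed_set[OF closed_closure _ _ l] by simp
next
  fix l assume l: "l \<in> (\<Inter>N. closure ((\<lambda>n. (y n, y (Suc n))) ` {N..}))"
  have "\<forall>k. \<exists>n\<ge>k. dist (y n, y (Suc n)) l < inverse (real (Suc k))"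
  proof
    fix k
    have "l \<in> closure ((\<lambda>n. (y n, y (Suc n))) ` {k..})" using l by blast
    then have "\<exists>z\<in>(\<lambda>n. (y n, y (Suc n))) ` {k..}. dist z l < inverse (real (Suc k))"
      unfolding closure_approachable by (elim allE impE) simp_all
    then show "\<exists>n\<ge>k. dist (y n, y (Suc n)) l < inverse (real (Suc k))" by auto
  qed
  then obtain s where s: "\<And>k. s k \<ge> k"
    and d: "\<And>k. dist (y (s k), y (Suc (s k))) l < inverse (real (Suc k))"
    using choice[of "\<lambda>k n. n \<ge> k \<and> dist (y n, y (Suc n)) l < inverse (real (Suc k))"] by blast
  have "filterlim s at_top sequentially"
    by (rule filterlim_at_top_mono[OF filterlim_ident]) (simp add: s)
  moreover have "(\<lambda>k. (y (s k), y (Suc (s k)))) \<longlonglongrightarrow> l"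
  proof (rule metric_tendsto_imp_tendsto[OF LIMSEQ_inverse_real_of_nat])
    show "\<forall>\<^sub>F k in sequentially. dist (y (s k), y (Suc (s k))) l \<le> dist (inverse (real (Suc k))) 0"
      using d by (auto intro!: always_eventually less_imp_le)
  qed
  ultimately show "l \<in> limit_pairs y" unfolding limit_pairs_def by blast
qed

locale bounded_orbit =
  fixes f :: "real \<Rightarrow> real \<Rightarrow> real" and c C :: real and y :: "nat \<Rightarrow> real"
  assumes range: "y n \<in> {c..C}"
    and rec: "y (Suc (Suc n)) = f (y (Suc n)) (y n)"
    and cont: "continuous_on ({c..C} \<times> {c..C}) (\<lambda>(u, v). f u v)"
begin

lemma convergent_subsequence:
  assumes "filterlim s at_top sequentially"
  obtains k l where "strict_mono k" "(\<lambda>i. (y (s (k i)), y (Suc (s (k i))))) \<longlonglongrightarrow> l"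
    "l \<in> limit_pairs y"
proof -
  have "compact ({c..C} \<times> {c..C})" by (intro compact_Times compact_Icc)
  moreover have "\<forall>i. (y (s i), y (Suc (s i))) \<in> {c..C} \<times> {c..C}" using range by auto
  ultimately obtain l and k :: "nat \<Rightarrow> nat" where k: "strict_mono k"
    and l: "((\<lambda>i. (y (s i), y (Suc (s i)))) \<circ> k) \<longlonglongrightarrow> l"
    by (rule seq_compactE[OF compact_imp_seq_compact]) (auto simp: o_def)
  have "filterlim (\<lambda>i. s (k i)) at_top sequentially"
    by (rule filterlim_compose[OF assms filterlim_subseq[OF k]])
  then have "l \<in> limit_pairs y" using l unfolding limit_pairs_def o_def by blast
  then show thesis using that k l unfolding o_def by blast
qed

lemma limit_pairs_nonempty: "limit_pairs y \<noteq> {}"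
  using convergent_subsequence[OF filterlim_ident] by blast

lemma limit_pairs_box: "limit_pairs y \<subseteq> {c..C} \<times> {c..C}"
proof
  fix l assume "l \<in> limit_pairs y"
  then have "l \<in> closure ((\<lambda>n. (y n, y (Suc n))) ` {0..})"
    unfolding limit_pairs_eq_Inter_closure by blast
  moreover have "closure ((\<lambda>n. (y n, y (Suc n))) ` {0..}) \<subseteq> {c..C} \<times> {c..C}"
    by (rule closure_minimal) (use range in \<open>auto intro!: closed_Times\<close>)
  ultimately show "l \<in> {c..C} \<times> {c..C}" by blast
qed

lemma compact_limit_pairs: "compact (limit_pairs y)"
proof -
  have "closed (limit_pairs y)" unfolding limit_pairs_eq_Inter_closure by blast
  moreover have "compact ({c..C} \<times> {c..C})" by (intro compact_Times compact_Icc)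
  ultimately show ?thesis using limit_pairs_box compact_Int_closed[of "{c..C} \<times> {c..C}"]
    by (metis inf.absorb2)
qed

lemma f_tendsto:
  assumes "a \<longlonglongrightarrow> u" "b \<longlonglongrightarrow> v" "\<And>k. a k \<in> {c..C}" "\<And>k. b k \<in> {c..C}"
  shows "(\<lambda>k. f (a k) (b k)) \<longlonglongrightarrow> f u v"
proof -
  have "u \<in> {c..C}" "v \<in> {c..C}"
    by (rule closed_sequentially[OF closed_atLeastAtMost _ assms(1)], use assms(3) in blast)
      (rule closed_sequentially[OF closed_atLeastAtMost _ assms(2)], use assms(4) in blast)
  then have "((\<lambda>(u, v). f u v) \<circ> (\<lambda>k. (a k, b k))) \<longlonglongrightarrow> (\<lambda>(u, v). f u v) (u, v)"
    using assms(3,4) tendsto_Pair[OF assms(1,2)]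
    by (intro continuous_on_sequentially[THEN iffD1, rule_format, OF cont]) auto
  then show ?thesis by (simp add: o_def)
qed

lemma limit_pairs_step:
  assumes "(x, z) \<in> limit_pairs y"
  shows "(z, f z x) \<in> limit_pairs y"
proof -
  obtain s where s: "filterlim s at_top sequentially"
    and l: "(\<lambda>k. (y (s k), y (Suc (s k)))) \<longlonglongrightarrow> (x, z)"
    using assms unfolding limit_pairs_def by blast
  have x: "(\<lambda>k. y (s k)) \<longlonglongrightarrow> x" and z: "(\<lambda>k. y (Suc (s k))) \<longlonglongrightarrow> z"
    using tendsto_fst[OF l] tendsto_snd[OF l] by simp_all
  have "(\<lambda>k. (y (Suc (s k)), y (Suc (Suc (s k))))) \<longlonglongrightarrow> (z, f z x)"
    unfolding rec by (intro tendsto_Pair z f_tendsto x range)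
  moreover have "filterlim (\<lambda>k. Suc (s k)) at_top sequentially"
    using s by (rule filterlim_compose[OF filterlim_Suc])
  ultimately show ?thesis unfolding limit_pairs_def by blast
qed

text \<open>
  Backward invariance is what makes extreme values useful: the largest and the smallest limit
  value are themselves values of \<open>f\<close> at limit pairs. It needs boundedness, since the preimage
  is obtained as a limit of the terms that precede a convergent subsequence.
\<close>

lemma limit_pairs_pre:
  assumes "(x, z) \<in> limit_pairs y"
  obtains t where "(t, x) \<in> limit_pairs y" "z = f x t"
proof -
  obtain s where s: "filterlim s at_top sequentially"
    and l: "(\<lambda>k. (y (s k), y (Suc (s k)))) \<longlonglongrightarrow> (x, z)"
    using assms unfolding limit_pairs_def by blast
  have "filterlim (\<lambda>k. s k - 1) at_top sequentially"
    using s by (rule filterlim_compose[OF filterlim_minus_const_nat_at_top])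
  then obtain k l' where k: "strict_mono k"
    and l': "(\<lambda>i. (y (s (k i) - 1), y (Suc (s (k i) - 1)))) \<longlonglongrightarrow> l'" "l' \<in> limit_pairs y"
    using convergent_subsequence by blast
  obtain t x' where "l' = (t, x')" by (cases l')
  with l' have lim: "(\<lambda>i. (y (s (k i) - 1), y (Suc (s (k i) - 1)))) \<longlonglongrightarrow> (t, x')"
    and mem: "(t, x') \<in> limit_pairs y" by simp_all
  have t: "(\<lambda>i. y (s (k i) - 1)) \<longlonglongrightarrow> t" and x': "(\<lambda>i. y (Suc (s (k i) - 1))) \<longlonglongrightarrow> x'"
    using tendsto_fst[OF lim] tendsto_snd[OF lim] by simp_all
  have x: "(\<lambda>i. y (s (k i))) \<longlonglongrightarrow> x" and z: "(\<lambda>i. y (Suc (s (k i)))) \<longlonglongrightarrow> z"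
    using LIMSEQ_subseq_LIMSEQ[OF tendsto_fst[OF l] k] LIMSEQ_subseq_LIMSEQ[OF tendsto_snd[OF l] k]
    by (simp_all add: o_def)
  have "filterlim (\<lambda>i. s (k i)) at_top sequentially"
    by (rule filterlim_compose[OF s filterlim_subseq[OF k]])
  then have pos: "\<forall>\<^sub>F i in sequentially. Suc (s (k i) - 1) = s (k i)"
    unfolding filterlim_at_top by (auto elim!: allE[of _ 1] eventually_mono)
  have "(\<lambda>i. y (s (k i))) \<longlonglongrightarrow> x'"
    by (rule Lim_transform_eventually[OF x']) (use pos in eventually_elim, simp)
  then have [simp]: "x' = x" using x LIMSEQ_unique by blast
  have "(\<lambda>i. f (y (Suc (s (k i) - 1))) (y (s (k i) - 1))) \<longlonglongrightarrow> f x' t"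
    by (intro f_tendsto t x' range)
  then have "(\<lambda>i. y (Suc (Suc (s (k i) - 1)))) \<longlonglongrightarrow> f x t" by (simp add: rec)
  then have "(\<lambda>i. y (Suc (s (k i)))) \<longlonglongrightarrow> f x t"
    by (rule Lim_transform_eventually) (use pos in eventually_elim, simp)
  then have "z = f x t" using z LIMSEQ_unique by blast
  then show thesis using that mem by simp
qed

lemma limit_pairs_extremes:
  obtains m M where "limit_pairs y \<subseteq> {m..M} \<times> {m..M}" "m \<le> M" "c \<le> m"
    "m \<in> fst ` limit_pairs y" "M \<in> fst ` limit_pairs y"
proof -
  have comp: "compact (fst ` limit_pairs y)"
    by (intro compact_continuous_image compact_limit_pairs continuous_on_fst continuous_on_id)
  have ne: "fst ` limit_pairs y \<noteq> {}" using limit_pairs_nonempty by blast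
  obtain m where m: "m \<in> fst ` limit_pairs y" "\<forall>t\<in>fst ` limit_pairs y. m \<le> t"
    using compact_attains_inf[OF comp ne] by blast
  obtain M where M: "M \<in> fst ` limit_pairs y" "\<forall>t\<in>fst ` limit_pairs y. t \<le> M"
    using compact_attains_sup[OF comp ne] by blast
  have "limit_pairs y \<subseteq> {m..M} \<times> {m..M}"
  proof
    fix l assume l: "l \<in> limit_pairs y"
    then have "(snd l, f (snd l) (fst l)) \<in> limit_pairs y" by (intro limit_pairs_step) simp
    then have "snd l \<in> fst ` limit_pairs y" by force
    moreover have "fst l \<in> fst ` limit_pairs y" using l by blast
    moreover have "t \<in> {m..M}" if "t \<in> fst ` limit_pairs y" for t
      using m(2)[rule_format, OF that] M(2)[rule_format, OF that] by simp
    ultimately show "l \<in> {m..M} \<times> {m..M}" unfolding mem_Times_iff by blast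
  qed
  moreover have "c \<le> m" using m(1) limit_pairs_box by auto
  ultimately show thesis using that m M by blast
qed

lemma limit_value_pre:
  assumes "t \<in> fst ` limit_pairs y"
  obtains u v where "(v, u) \<in> limit_pairs y" "t = f u v"
proof -
  obtain z where "(t, z) \<in> limit_pairs y" using assms by auto
  then obtain u where "(u, t) \<in> limit_pairs y" by (rule limit_pairs_pre)
  then obtain v where "(v, u) \<in> limit_pairs y" "t = f u v" by (rule limit_pairs_pre)
  then show thesis by (rule that)
qed

lemma tendsto_of_limit_pairs:
  assumes "limit_pairs y \<subseteq> {(e, e)}"
  shows "y \<longlonglongrightarrow> e"
proof (rule ccontr)
  assume "\<not> y \<longlonglongrightarrow> e"
  then obtain \<epsilon> where e: "\<epsilon> > 0" and "\<forall>N. \<exists>n\<ge>N. \<not> dist (y n) e < \<epsilon>"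
    unfolding lim_sequentially by blast
  then obtain s where s: "\<And>N. s N \<ge> N" "\<And>N. dist (y (s N)) e \<ge> \<epsilon>"
    using choice[of "\<lambda>N n. n \<ge> N \<and> \<not> dist (y n) e < \<epsilon>"] by (auto simp: not_less)
  have "filterlim s at_top sequentially"
    by (rule filterlim_at_top_mono[OF filterlim_ident]) (simp add: s)
  then obtain k l where l: "(\<lambda>i. (y (s (k i)), y (Suc (s (k i))))) \<longlonglongrightarrow> l" "l \<in> limit_pairs y"
    using convergent_subsequence by blast
  then have "(\<lambda>i. y (s (k i))) \<longlonglongrightarrow> e" using tendsto_fst[OF l(1)] assms by auto
  then have "\<exists>i. dist (y (s (k i))) e < \<epsilon>" using e unfolding lim_sequentially by blast
  then show False using s(2) by (meson not_less)
qed

text \<open>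
  LaSalle's principle. On the compact invariant limit set, a minimum of \<open>W\<close> has its image,
  and a maximum its preimage, at the same level, so strict decrease forces both to be periodic
  of period two. If \<open>(e, e)\<close> is the only such pair, then the minimum and the maximum of \<open>W\<close>
  agree, every limit pair is a minimum, and the limit set is \<open>{(e, e)}\<close>.
\<close>

lemma limit_pairs_Lyapunov:
  fixes W :: "real \<times> real \<Rightarrow> real"
  assumes W: "continuous_on (limit_pairs y) W"
    and sym: "\<And>x z. W (x, z) = W (z, x)"
    and less: "\<And>x z. (x, z) \<in> limit_pairs y \<Longrightarrow> f z x \<noteq> x \<Longrightarrow> W (z, f z x) < W (x, z)"
    and two: "\<And>x z. (x, z) \<in> limit_pairs y \<Longrightarrow> f z x = x \<Longrightarrow> f x z = z \<Longrightarrow> (x, z) = (e, e)"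
  shows "limit_pairs y \<subseteq> {(e, e)}"
proof -
  let ?Om = "limit_pairs y"
  have min: "(x, z) = (e, e)" if xz: "(x, z) \<in> ?Om" and le: "\<forall>l\<in>?Om. W (x, z) \<le> W l" for x z
  proof -
    have 1: "f z x = x" using less[OF xz] le[rule_format, OF limit_pairs_step[OF xz]] by linarith
    have zx: "(z, x) \<in> ?Om" using limit_pairs_step[OF xz] unfolding 1 .
    have "f x z = z"
      using less[OF zx] le[rule_format, OF limit_pairs_step[OF zx]] sym[of x z] by linarith
    then show ?thesis using two[OF xz 1] by blast
  qed
  have max: "(x, z) = (e, e)" if xz: "(x, z) \<in> ?Om" and ge: "\<forall>l\<in>?Om. W l \<le> W (x, z)" for x z
  proof -
    obtain t where t: "(t, x) \<in> ?Om" "z = f x t" by (rule limit_pairs_pre[OF xz])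
    have "t = z" using less[OF t(1)] ge[rule_format, OF t(1)] unfolding t(2)[symmetric] by linarith
    then have zx: "(z, x) \<in> ?Om" and 1: "f x z = z" using t by metis+
    obtain t' where t': "(t', z) \<in> ?Om" "x = f z t'" by (rule limit_pairs_pre[OF zx])
    have "t' = x"
      using less[OF t'(1)] ge[rule_format, OF t'(1)] sym[of x z] unfolding t'(2)[symmetric] by linarith
    then have "f z x = x" using t' by metis
    then show ?thesis using two[OF xz _ 1] by blast
  qed
  obtain l0 where "l0 \<in> ?Om" "\<forall>l\<in>?Om. W l0 \<le> W l"
    using continuous_attains_inf[OF compact_limit_pairs limit_pairs_nonempty W] by blast
  then have lo: "\<forall>l\<in>?Om. W (e, e) \<le> W l" using min[of "fst l0" "snd l0"] by simp
  obtain l1 where "l1 \<in> ?Om" "\<forall>l\<in>?Om. W l \<le> W l1"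
    using continuous_attains_sup[OF compact_limit_pairs limit_pairs_nonempty W] by blast
  then have hi: "\<forall>l\<in>?Om. W l \<le> W (e, e)" using max[of "fst l1" "snd l1"] by simp
  show ?thesis
  proof
    fix l assume l: "l \<in> ?Om"
    then have "\<forall>l'\<in>?Om. W l \<le> W l'" using lo hi by force
    then show "l \<in> {(e, e)}" using min[of "fst l" "snd l"] l by simp
  qed
qed

end

section \<open>Monotonicity of the even and odd subsequences\<close>

lemma monotone_bounded_converges:
  fixes a :: "nat \<Rightarrow> real"
  assumes "\<And>j. a j \<in> {lo..hi}" and "(\<forall>j. a j \<le> a (Suc j)) \<or> (\<forall>j. a (Suc j) \<le> a j)"
  shows "\<exists>L. a \<longlonglongrightarrow> L"
proof -
  have "norm (a j) \<le> max \<bar>lo\<bar> \<bar>hi\<bar>" for j using assms(1)[of j] by auto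
  then have "Bseq a" by (rule BseqI')
  moreover have "monoseq a" using assms(2) by (auto simp: monoseq_Suc)
  ultimately show ?thesis using Bseq_monoseq_convergent unfolding convergent_def by blast
qed

text \<open>
  For a map that decreases in its first and increases in its second argument, the signs of
  \<open>z (n + 2) - z n\<close> propagate: opposite weak signs at \<open>n\<close> and \<open>n + 1\<close> persist, with
  the pattern kept along each parity class. If opposite signs never occur, then all signs are
  equal. Either way the terms of even and of odd index are eventually monotone.
\<close>

lemma even_odd_subsequences_converge:
  fixes g :: "real \<Rightarrow> real \<Rightarrow> real"
  assumes range: "\<And>n. z n \<in> {lo..hi}" and rec: "\<And>n. z (Suc (Suc n)) = g (z (Suc n)) (z n)"
    and anti: "\<And>u u' v. u \<in> {lo..hi} \<Longrightarrow> u' \<in> {lo..hi} \<Longrightarrow> v \<in> {lo..hi} \<Longrightarrow> u \<le> u' \<Longrightarrow> g u' v \<le> g u v"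
    and mono: "\<And>u v v'. u \<in> {lo..hi} \<Longrightarrow> v \<in> {lo..hi} \<Longrightarrow> v' \<in> {lo..hi} \<Longrightarrow> v \<le> v' \<Longrightarrow> g u v \<le> g u v'"
  shows "\<exists>k a b. (\<lambda>j. z (k + 2 * j)) \<longlonglongrightarrow> a \<and> (\<lambda>j. z (Suc (k + 2 * j))) \<longlonglongrightarrow> b"
proof -
  have le: "g u v \<le> g u' v'" if "u \<in> {lo..hi}" "u' \<in> {lo..hi}" "v \<in> {lo..hi}" "v' \<in> {lo..hi}" "u' \<le> u" "v \<le> v'"
    for u u' v v' using anti[of u' u v] mono[of u' v v'] that by linarith
  have stepA: "z (Suc (Suc n)) \<le> z (Suc (Suc (Suc (Suc n))))" 
    if "z n \<le> z (Suc (Suc n))" "z (Suc (Suc (Suc n))) \<le> z (Suc n)" for n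
    using le[OF range range range range that(2,1)] unfolding rec[symmetric] .
  have stepB: "z (Suc (Suc (Suc (Suc n)))) \<le> z (Suc (Suc n))"
    if "z (Suc (Suc n)) \<le> z n" "z (Suc n) \<le> z (Suc (Suc (Suc n)))" for n
    using le[OF range range range range that(2,1)] unfolding rec[symmetric] .
  have "\<exists>k. ((\<forall>j. z (k + 2 * j) \<le> z (k + 2 * Suc j)) \<or> (\<forall>j. z (k + 2 * Suc j) \<le> z (k + 2 * j))) \<and>
     ((\<forall>j. z (Suc (k + 2 * j)) \<le> z (Suc (k + 2 * Suc j))) \<or> (\<forall>j. z (Suc (k + 2 * Suc j)) \<le> z (Suc (k + 2 * j))))"
  proof (cases "\<exists>k. (z k \<le> z (Suc (Suc k)) \<and> z (Suc (Suc (Suc k))) \<le> z (Suc k)) \<or>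
      (z (Suc (Suc k)) \<le> z k \<and> z (Suc k) \<le> z (Suc (Suc (Suc k))))")
    case True
    then obtain k where "(z k \<le> z (Suc (Suc k)) \<and> z (Suc (Suc (Suc k))) \<le> z (Suc k)) \<or>
      (z (Suc (Suc k)) \<le> z k \<and> z (Suc k) \<le> z (Suc (Suc (Suc k))))" by blast
    then show ?thesis
    proof
      assume *: "z k \<le> z (Suc (Suc k)) \<and> z (Suc (Suc (Suc k))) \<le> z (Suc k)"
      have "z (k + 2 * j) \<le> z (Suc (Suc (k + 2 * j))) \<and> z (Suc (Suc (Suc (k + 2 * j)))) \<le> z (Suc (k + 2 * j))" for j
      proof (induction j)
        case (Suc j)
        then show ?case using stepA[of "k + 2 * j"] stepB[of "Suc (k + 2 * j)"] by simp
      qed (use * in simp)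
      then show ?thesis by (intro exI[of _ k]) auto
    next
      assume *: "z (Suc (Suc k)) \<le> z k \<and> z (Suc k) \<le> z (Suc (Suc (Suc k)))"
      have "z (Suc (Suc (k + 2 * j))) \<le> z (k + 2 * j) \<and> z (Suc (k + 2 * j)) \<le> z (Suc (Suc (Suc (k + 2 * j))))" for j
      proof (induction j)
        case (Suc j)
        then show ?case using stepB[of "k + 2 * j"] stepA[of "Suc (k + 2 * j)"] by simp
      qed (use * in simp)
      then show ?thesis by (intro exI[of _ k]) auto
    qed
  next
    case False
    then have same: "z n < z (Suc (Suc n)) \<longleftrightarrow> z (Suc n) < z (Suc (Suc (Suc n)))"
      "z n \<noteq> z (Suc (Suc n))" for n by (metis linorder_le_cases not_le)+
    have "z n < z (Suc (Suc n)) \<longleftrightarrow> z 0 < z (Suc (Suc 0))" for n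
      by (induction n) (use same in auto)
    then have "(\<forall>n. z n \<le> z (Suc (Suc n))) \<or> (\<forall>n. z (Suc (Suc n)) \<le> z n)"
      using same(2) by (metis less_imp_le linorder_neqE_linordered_idom)
    then show ?thesis by (intro exI[of _ 0]) auto
  qed
  then obtain k where
    "(\<forall>j. z (k + 2 * j) \<le> z (k + 2 * Suc j)) \<or> (\<forall>j. z (k + 2 * Suc j) \<le> z (k + 2 * j))"
    "(\<forall>j. z (Suc (k + 2 * j)) \<le> z (Suc (k + 2 * Suc j))) \<or> (\<forall>j. z (Suc (k + 2 * Suc j)) \<le> z (Suc (k + 2 * j)))"
    by blast
  from monotone_bounded_converges[OF range this(1)] monotone_bounded_converges[OF range this(2)]
  show ?thesis by blast
qed

section \<open>A deformation of the invariant of Lyness' recursion\<close>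

text \<open>
  The Lyapunov function is
  \<open>W (x, y) = L x + L y + ln (a + x + y - \<delta> * x * y)\<close> for a primitive \<open>L\<close>
  of \<open>- (\<beta> - B * t - \<delta> * (t\<^sup>2 + A * t - \<alpha>)) / Q t\<close>. It generalizes the
  logarithm of the invariant
  \<open>(\<beta> + x) * (\<beta> + y) * (\<alpha> + \<beta> * x + \<beta> * y) / (x * y)\<close> of Lyness'
  recursion, which is the case \<open>A = B = 0\<close> with \<open>a = \<alpha> / \<beta>\<close> and \<open>\<delta> = 0\<close>.

  The rational function in the definition of \<open>L\<close> and the polynomial \<open>Q\<close> are found by
  requiring that for every \<open>y\<close> the derivative of \<open>W (y, t)\<close> in \<open>t\<close> has the sign of
  \<open>P y t = t\<^sup>2 + (A + B * y) * t - \<alpha> - \<beta> * y\<close>. So \<open>W (y, t)\<close> is least at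
  the fixed point \<open>p\<close> of the decreasing function \<open>w y\<close>, and \<open>x\<close> and \<open>w y x\<close> lie on opposite
  sides of \<open>p\<close>. Both sides of \<open>W (y, w y x) < W (y, x)\<close> agree at \<open>x = p\<close>. When \<open>x\<close>
  moves away from \<open>p\<close>, the inequality \<open>key\<close> says that the right-hand side grows faster.
\<close>

lemma Lyapunov_function_if_key_inequality:
  fixes A B \<alpha> \<beta> \<delta> a l h :: real
  defines "Q \<equiv> \<lambda>t. (t\<^sup>2 + A * t - \<alpha>) * (1 - \<delta> * t) + (\<beta> - B * t) * (a + t)"
    and "V \<equiv> \<lambda>y t. a + y + t - \<delta> * y * t"
    and "w \<equiv> \<lambda>y x. (\<alpha> + \<beta> * y) / (x + A + B * y)"
  assumes lh: "0 \<le> l" "l \<le> h"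
    and pos: "A > 0" "B > 0" "\<alpha> > 0" "\<beta> > 0" "1 + a * \<delta> > 0"
    and Q: "\<And>t. t \<in> {l..h} \<Longrightarrow> Q t > 0"
    and V: "\<And>y t. y \<in> {l..h} \<Longrightarrow> t \<in> {l..h} \<Longrightarrow> V y t > 0"
    and key: "\<And>y x. y \<in> {l..h} \<Longrightarrow> x \<in> {l..h} \<Longrightarrow> w y x \<in> {l..h} \<Longrightarrow>
       (w y x)\<^sup>2 * (Q x * V y x) < (x + A + B * y)\<^sup>2 * (Q (w y x) * V y (w y x))"
  obtains W :: "real \<times> real \<Rightarrow> real" where "continuous_on ({l..h} \<times> {l..h}) W" "\<And>x y. W (x, y) = W (y, x)"
    "\<And>x y. y \<in> {l..h} \<Longrightarrow> x \<in> {l..h} \<Longrightarrow> w y x \<in> {l..h} \<Longrightarrow> w y x \<noteq> x \<Longrightarrow>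
       W (y, w y x) < W (x, y)"
proof -
  define q where "q = (\<lambda>t. - (\<beta> - B * t - \<delta> * (t\<^sup>2 + A * t - \<alpha>)) / Q t)"
  have "continuous_on {l..h} q"
    unfolding q_def using Q unfolding Q_def
    by (intro continuous_intros) (metis less_irrefl)
  then obtain L where L: "\<And>t. t \<in> {l..h} \<Longrightarrow> (L has_vector_derivative q t) (at t within {l..h})"
    using antiderivative_continuous by blast
  have contL: "continuous_on {l..h} L"
    using L has_vector_derivative_continuous continuous_on_eq_continuous_within by blast
  define U where "U = (\<lambda>y t. L t + ln (V y t))"
  define P where "P = (\<lambda>y t. t\<^sup>2 + (A + B * y) * t - \<alpha> - \<beta> * y)"
  have contU: "continuous_on {l..h} (U y)" if y: "y \<in> {l..h}" for y
    unfolding U_def using V[OF y] unfolding V_def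
    by (intro continuous_intros contL) (metis less_irrefl)
  \<comment> \<open>The point of the choice of \<open>Q\<close>: the numerators of \<open>q t\<close> and of the logarithmic derivative
    combine to a multiple of \<open>P y t\<close>.\<close>
  have derU: "(U y has_field_derivative (1 + a * \<delta>) * (P y t / (Q t * V y t))) (at t)"
    if y: "y \<in> {l..h}" and t: "t \<in> {l<..<h}" for y t
  proof -
    have tt: "t \<in> {l..h}" using t by simp
    have "(L has_field_derivative q t) (at t within {l..h})"
      using L[OF tt] by (simp add: has_real_derivative_iff_has_vector_derivative)
    then have "(L has_field_derivative q t) (at t)"
      using t by (simp add: at_within_Icc_at)
    then have "(U y has_field_derivative q t + (1 - \<delta> * y) / V y t) (at t)"
      unfolding U_def V_def using V[OF y tt] unfolding V_def
      by (auto intro!: derivative_eq_intros simp: field_simps)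
    moreover have "q t + (1 - \<delta> * y) / V y t = (1 + a * \<delta>) * (P y t / (Q t * V y t))"
    proof -
      have "- (\<beta> - B * t - \<delta> * (t\<^sup>2 + A * t - \<alpha>)) * V y t + (1 - \<delta> * y) * Q t = (1 + a * \<delta>) * P y t"
        unfolding V_def Q_def P_def by algebra
      then show ?thesis
        using Q[OF tt] V[OF y tt] unfolding q_def by (simp add: divide_simps)
    qed
    ultimately show ?thesis by simp
  qed
  \<comment> \<open>By symmetry of \<open>W\<close>, the step from \<open>(x, y)\<close> to \<open>(y, w y x)\<close> only moves the second argument of
    \<open>W (y, _)\<close> from \<open>x\<close> to \<open>w y x\<close>.\<close>
  have dec: "U y (w y x) < U y x"
    if y: "y \<in> {l..h}" and x: "x \<in> {l..h}" and wx: "w y x \<in> {l..h}" and ne: "w y x \<noteq> x" for x y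
  proof -
    define N where "N = \<alpha> + \<beta> * y"
    define E where "E = A + B * y"
    have N: "N > 0" and E: "E > 0"
      unfolding N_def E_def using y lh pos by (auto intro!: add_pos_nonneg)
    have w: "w y t = N / (t + E)" for t unfolding w_def N_def E_def by (simp add: add.assoc)
    have anti: "w y t' < w y t" if "l \<le> t" "t < t'" for t t'
      unfolding w using that lh N E by (intro divide_strict_left_mono) auto
    have contw: "continuous_on {s..t} (w y)" if "l \<le> s" for s t
      unfolding w using that lh E by (intro continuous_intros) auto
    have derw: "(w y has_field_derivative - (w y t / (t + E))) (at t)" if "l \<le> t" for t
      unfolding w using that lh E
      by (auto intro!: derivative_eq_intros simp: divide_simps)
    define d where "d = (\<lambda>t. (1 + a * \<delta>) * (w y t - t) *
      ((t + E) / (Q t * V y t) - (w y t)\<^sup>2 / ((t + E) * (Q (w y t) * V y (w y t)))))"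
    have der: "((\<lambda>t. U y (w y t) - U y t) has_field_derivative d t) (at t)"
      if t: "t \<in> {l<..<h}" and wt: "w y t \<in> {l<..<h}" for t
    proof -
      have tE: "t + E > 0" using t lh E by auto
      have NE: "N = w y t * (t + E)" using tE by (simp add: w)
      have Pt: "P y t = (t - w y t) * (t + E)"
        using NE unfolding P_def N_def E_def by algebra
      have Pw: "P y (w y t) = w y t * (w y t - t)"
        using NE unfolding P_def N_def E_def by algebra
      have "((\<lambda>t. U y (w y t) - U y t) has_field_derivative
          (1 + a * \<delta>) * (P y (w y t) / (Q (w y t) * V y (w y t))) * (- (w y t / (t + E))) -
          (1 + a * \<delta>) * (P y t / (Q t * V y t))) (at t)"
        using t by (intro DERIV_diff DERIV_chain2[OF derU derw] derU y wt) auto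
      moreover have "(1 + a * \<delta>) * (P y (w y t) / (Q (w y t) * V y (w y t))) * (- (w y t / (t + E))) -
          (1 + a * \<delta>) * (P y t / (Q t * V y t)) = d t"
        unfolding Pt Pw d_def by (simp add: algebra_simps power2_eq_square diff_divide_distrib add_divide_distrib)
      ultimately show ?thesis by simp
    qed
    have fac: "(t + E) / (Q t * V y t) - (w y t)\<^sup>2 / ((t + E) * (Q (w y t) * V y (w y t))) > 0"
      if t: "t \<in> {l..h}" and wt: "w y t \<in> {l..h}" for t
    proof -
      have tE: "t + E > 0" using t lh E by auto
      have 1: "Q t * V y t > 0" "Q (w y t) * V y (w y t) > 0"
        using Q V y t wt by simp_all
      have "(w y t)\<^sup>2 * (Q t * V y t) < (t + E) * ((t + E) * (Q (w y t) * V y (w y t)))"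
        using key[OF y t wt] unfolding E_def by (simp add: power2_eq_square add.assoc mult.assoc)
      moreover have "k / (e * b) < e / a" if "k * a < e * (e * b)" "a > 0" "b > 0" "e > 0" for k a b e :: real
        using that by (simp add: field_simps)
      ultimately show ?thesis using 1 tE by simp
    qed
    have fixpt: "\<exists>p. s \<le> p \<and> p \<le> t \<and> w y p = p" if "l \<le> s" "s \<le> t" "s \<le> w y s" "w y t \<le> t" for s t
    proof -
      have "continuous_on {s..t} (\<lambda>t. w y t - t)"
        by (intro continuous_on_diff contw that continuous_on_id)
      then show ?thesis using IVT2'[of "\<lambda>t. w y t - t" t 0 s] that by auto
    qed
    show ?thesis
    proof (cases "x < w y x")
      case True
      have "w y (w y x) < w y x" using anti[of x "w y x"] True x by auto
      then obtain p where p: "x \<le> p" "p \<le> w y x" "w y p = p"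
        using fixpt[of x "w y x"] True x by auto
      have "x < p" using p ne by (cases "x = p") auto
      have "U y (w y x) - U y x < U y (w y p) - U y p"
      proof (rule DERIV_pos_imp_increasing_open[OF \<open>x < p\<close>])
        fix t assume t: "x < t" "t < p"
        have "p < w y t" using anti[of t p] t x p by auto
        moreover have "w y t < w y x" using anti[of x t] t x by auto
        ultimately have tJ: "t \<in> {l<..<h}" and wJ: "w y t \<in> {l<..<h}" and "t < w y t"
          using t x p wx by auto
        then have "d t > 0"
          unfolding d_def using fac[of t] pos(5) by (intro mult_pos_pos) auto
        then show "\<exists>z. ((\<lambda>t. U y (w y t) - U y t) has_real_derivative z) (at t) \<and> 0 < z"
          using der[OF tJ wJ] by blast
      next
        show "continuous_on {x..p} (\<lambda>t. U y (w y t) - U y t)"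
        proof (intro continuous_on_diff continuous_on_compose2[OF contU[OF y]] contw)
          show "w y ` {x..p} \<subseteq> {l..h}"
          proof
            fix s assume "s \<in> w y ` {x..p}"
            then obtain t where t: "s = w y t" "x \<le> t" "t \<le> p" by auto
            have "w y t \<le> w y x" using anti[of x t] t x by (cases "x = t") auto
            moreover have "p \<le> w y t" using anti[of t p] t x p by (cases "t = p") auto
            ultimately show "s \<in> {l..h}" using t p x wx by auto
          qed
        qed (use x p wx in auto)
      qed
      then show ?thesis using p by simp
    next
      case False
      then have less: "w y x < x" using ne by simp
      have "w y x < w y (w y x)" using anti[of "w y x" x] less wx by auto
      then obtain p where p: "w y x \<le> p" "p \<le> x" "w y p = p"
        using fixpt[of "w y x" x] less wx by auto
      have "p < x" using p ne by (cases "x = p") auto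
      have "U y (w y p) - U y p > U y (w y x) - U y x"
      proof (rule DERIV_neg_imp_decreasing_open[OF \<open>p < x\<close>])
        fix t assume t: "p < t" "t < x"
        have "w y t < p" using anti[of p t] t wx p by auto
        moreover have "w y x < w y t" using anti[of t x] t wx p by auto
        ultimately have tJ: "t \<in> {l<..<h}" and wJ: "w y t \<in> {l<..<h}" and "w y t < t"
          using t x p wx by auto
        then have "d t < 0"
          unfolding d_def using fac[of t] pos(5) by (intro mult_neg_pos mult_pos_neg) auto
        then show "\<exists>z. ((\<lambda>t. U y (w y t) - U y t) has_real_derivative z) (at t) \<and> z < 0"
          using der[OF tJ wJ] by blast
      next
        show "continuous_on {p..x} (\<lambda>t. U y (w y t) - U y t)"
        proof (intro continuous_on_diff continuous_on_compose2[OF contU[OF y]] contw)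
          show "w y ` {p..x} \<subseteq> {l..h}"
          proof
            fix s assume "s \<in> w y ` {p..x}"
            then obtain t where t: "s = w y t" "p \<le> t" "t \<le> x" by auto
            have "w y x \<le> w y t" using anti[of t x] t wx p by (cases "x = t") auto
            moreover have "w y t \<le> p" using anti[of p t] t wx p by (cases "t = p") auto
            ultimately show "s \<in> {l..h}" using t p x wx by auto
          qed
        qed (use x p wx in auto)
      qed
      then show ?thesis using p by simp
    qed
  qed
  define W where "W = (\<lambda>(x, y). L x + L y + ln (V x y))"
  have sym: "W (x, y) = W (y, x)" for x y
    unfolding W_def V_def by (simp add: algebra_simps)
  have "continuous_on ({l..h} \<times> {l..h}) (\<lambda>z. L (fst z) + L (snd z) + ln (V (fst z) (snd z)))"
    using V unfolding V_def
    by (intro continuous_intros continuous_on_compose2[OF contL]) (auto, metis less_irrefl)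
  then have "continuous_on ({l..h} \<times> {l..h}) W" unfolding W_def by (simp add: case_prod_beta)
  moreover have "W (y, w y x) < W (x, y)"
    if "y \<in> {l..h}" "x \<in> {l..h}" "w y x \<in> {l..h}" "w y x \<noteq> x" for x y
    using dec[OF that] unfolding sym[of x y] by (simp add: W_def U_def)
  ultimately show thesis by (intro that[of W] sym)
qed

text \<open>
  The inequality \<open>key\<close> above, with denominators cleared, for the parameters of
  \<open>Lyapunov_function_high_threshold\<close> below. There \<open>L\<^sub>1, L\<^sub>2\<close> are multiples of \<open>Q\<close> and \<open>V y\<close>
  at \<open>w y x\<close>, and \<open>R\<^sub>1, R\<^sub>2\<close> are multiples of \<open>Q\<close> and \<open>V y\<close> at \<open>x\<close>.

  The point \<open>2 * n\<close> is mapped to \<open>\<sigma>\<close> by \<open>w y\<close> for every \<open>y\<close>, so \<open>{2 * n..\<sigma>}\<close> is the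
  natural range. With the nonnegative coordinates \<open>X = x - 2 * n\<close>, \<open>Z = \<sigma> - x\<close> and
  \<open>F = B * (y - 2 * n)\<close> the difference of the two sides is a polynomial in
  \<open>A, B, n, X, Z, F\<close> all of whose coefficients are nonnegative. It is grouped by powers
  of \<open>Z\<close> here, and \<open>E0, \<dots>, E3\<close> are expanded: once the expansions are written down, the
  positivity is visible term by term. The expansion of \<open>E0\<close> uses \<open>G = B * y\<close> in place of
  \<open>F\<close>, which is shorter and still has nonnegative coefficients.
\<close>

lemma key_polynomial:
  fixes A B n x \<sigma> y :: real
  defines "H \<equiv> A + 2 * n" and "u \<equiv> A + 2 * n + B * y" and "D \<equiv> x + A + B * y"
  defines "R\<^sub>1 \<equiv> \<sigma> * H * (x - n) * (x + B * (\<sigma> - x)) - n * x\<^sup>2 * (x + A)"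
    and "R\<^sub>2 \<equiv> H * (\<sigma> * u + B * \<sigma> * x - n * \<sigma> * B) - n * (B * y) * x"
    and "L\<^sub>1 \<equiv> H * (\<sigma> * u - n * D) * (u + B * (x - 2 * n)) * D - n * u\<^sup>2 * (\<sigma> * u + A * D)"
    and "L\<^sub>2 \<equiv> H * (u * D + B * \<sigma> * u - n * B * D) - n * (B * y) * u"
  assumes pos: "A > 0" "B > 0" "n > 0" and x: "2 * n \<le> x" "x \<le> \<sigma>" and y: "2 * n \<le> y" and \<sigma>: "2 * n < \<sigma>"
  shows "0 < R\<^sub>1" and "0 < R\<^sub>2" and "u\<^sup>2 * (R\<^sub>1 * R\<^sub>2) < \<sigma> * (L\<^sub>1 * L\<^sub>2)"
proof -
  define X where "X = x - 2 * n"
  define Z where "Z = \<sigma> - x"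
  define F where "F = B * y - 2 * n * B"
  define G where "G = B * y"
  \<comment> \<open>Coefficients with respect to \<open>Z\<close>: \<open>L\<^sub>1 = X * lam + u * rho * Z\<close>,
    \<open>L\<^sub>2 = m + H * B * u * Z\<close>, \<open>R\<^sub>2 = x * tau + (tau + n * G) * Z\<close>.\<close>
  define lam where "lam = H * u * (X + u) * (u - n) + H * B * (X + u) * (n * u + X * (u - n)) - n * u * u * (u - 2 * n)"
  define tau where "tau = H * (u + B * (n + X)) - n * G"
  define m where "m = u * tau + H * X * (u - B * n)"
  define rho where "rho = H * (u + B * X) * (X + u) - n * u * u"
  define psi where "psi = rho * m + X * lam * H * B"
  have X: "0 \<le> X" and Z: "0 \<le> Z" and XZ: "0 < X \<or> 0 < Z"
    using x \<sigma> unfolding X_def Z_def by linarith+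
  have F: "0 \<le> F" using pos y unfolding F_def by (simp add: mult.commute)
  have G: "0 \<le> G" using pos y unfolding G_def by simp
  have uG: "u = H + G" unfolding u_def H_def G_def by simp
  have GF: "G = 2 * n * B + F" unfolding G_def F_def by simp
  have xX: "x = 2 * n + X" and sZ: "\<sigma> = 2 * n + X + Z" and DX: "D = X + u"
    unfolding X_def Z_def D_def u_def by simp_all
  have H: "H > 2 * n" "H > 0" and u: "u > 2 * n" "u > 0" using pos G unfolding uG H_def by simp_all
  note nonneg = add_nonneg_nonneg mult_nonneg_nonneg zero_le_power
  define E0 where "E0 = lam * m - u\<^sup>2 * x\<^sup>2 * (H - n) * tau"
  define E1 where "E1 = psi - u * x * (X * (H - n) * n * G + H * (n + X) * (1 + B) * tau)"
  define E2 where "E2 = psi + x * rho * H * B * u - u * x * H * (n + X) * ((1 + B) * (tau + n * G) + B * tau)"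
  define E3 where "E3 = rho * u - u * (n + X) * (tau + n * G)"
  have E0: "E0 > 0"
  proof -
    have "E0 = A^7 + (5*A^6*G + 2*A^6*n*B + 12*A^6*n + 2*A^6*X*B + 2*A^6*X + 10*A^5*G^2 + 8*A^5*G*n*B +
      50*A^5*G*n + 8*A^5*G*X*B + 8*A^5*G*X + A^5*n^2*B^2 + 22*A^5*n^2*B + 58*A^5*n^2 +
      2*A^5*n*X*B^2 + 23*A^5*n*X*B + 17*A^5*n*X + A^5*X^2*B^2 + 3*A^5*X^2*B + 10*A^4*G^3 +
      12*A^4*G^2*n*B + 80*A^4*G^2*n + 12*A^4*G^2*X*B + 12*A^4*G^2*X + 3*A^4*G*n^2*B^2 +
      72*A^4*G*n^2*B + 198*A^4*G*n^2 + 6*A^4*G*n*X*B^2 + 75*A^4*G*n*X*B + 57*A^4*G*n*X +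
      3*A^4*G*X^2*B^2 + 9*A^4*G*X^2*B + 10*A^4*n^3*B^2 + 98*A^4*n^3*B + 144*A^4*n^3 +
      19*A^4*n^2*X*B^2 + 105*A^4*n^2*X*B + 56*A^4*n^2*X + 10*A^4*n*X^2*B^2 + 22*A^4*n*X^2*B +
      A^4*X^3*B^2 + 5*A^3*G^4 + 8*A^3*G^3*n*B + 60*A^3*G^3*n + 8*A^3*G^3*X*B + 8*A^3*G^3*X +
      3*A^3*G^2*n^2*B^2 + 84*A^3*G^2*n^2*B + 247*A^3*G^2*n^2 + 6*A^3*G^2*n*X*B^2 +
      87*A^3*G^2*n*X*B + 69*A^3*G^2*n*X + 3*A^3*G^2*X^2*B^2 + 9*A^3*G^2*X^2*B + 24*A^3*G*n^3*B^2
      + 254*A^3*G*n^3*B + 398*A^3*G*n^3 + 46*A^3*G*n^2*X*B^2 + 273*A^3*G*n^2*X*B +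
      159*A^3*G*n^2*X + 24*A^3*G*n*X^2*B^2 + 55*A^3*G*n*X^2*B + 2*A^3*G*n*X^2 + 2*A^3*G*X^3*B^2
      + 40*A^3*n^4*B^2 + 228*A^3*n^4*B + 192*A^3*n^4 + 72*A^3*n^3*X*B^2 + 246*A^3*n^3*X*B +
      88*A^3*n^3*X + 39*A^3*n^2*X^2*B^2 + 62*A^3*n^2*X^2*B + 6*A^3*n*X^3*B^2 + A^2*G^5 +
      2*A^2*G^4*n*B + 20*A^2*G^4*n + 2*A^2*G^4*X*B + 2*A^2*G^4*X + A^2*G^3*n^2*B^2 +
      40*A^2*G^3*n^2*B + 133*A^2*G^3*n^2 + 2*A^2*G^3*n*X*B^2 + 41*A^2*G^3*n*X*B + 35*A^2*G^3*n*X
      + A^2*G^3*X^2*B^2 + 3*A^2*G^3*X^2*B + 18*A^2*G^2*n^3*B^2 + 218*A^2*G^2*n^3*B +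
      376*A^2*G^2*n^3 + 35*A^2*G^2*n^2*X*B^2 + 235*A^2*G^2*n^2*X*B + 154*A^2*G^2*n^2*X +
      18*A^2*G^2*n*X^2*B^2 + 44*A^2*G^2*n*X^2*B + 4*A^2*G^2*n*X^2 + A^2*G^2*X^3*B^2 +
      72*A^2*G*n^4*B^2 + 444*A^2*G*n^4*B + 432*A^2*G*n^4 + 132*A^2*G*n^3*X*B^2 +
      490*A^2*G*n^3*X*B + 222*A^2*G*n^3*X + 71*A^2*G*n^2*X^2*B^2 + 126*A^2*G*n^2*X^2*B +
      11*A^2*G*n^2*X^2 + 10*A^2*G*n*X^3*B^2 + A^2*G*n*X^3*B + 80*A^2*n^5*B^2 + 296*A^2*n^5*B +
      128*A^2*n^5 + 136*A^2*n^4*X*B^2 + 316*A^2*n^4*X*B + 64*A^2*n^4*X + 74*A^2*n^3*X^2*B^2 +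
      84*A^2*n^3*X^2*B + 13*A^2*n^2*X^3*B^2 + 2*A*G^5*n + 6*A*G^4*n^2*B + 27*A*G^4*n^2 +
      6*A*G^4*n*X*B + 6*A*G^4*n*X + 4*A*G^3*n^3*B^2 + 66*A*G^3*n^3*B + 134*A*G^3*n^3 +
      8*A*G^3*n^2*X*B^2 + 71*A*G^3*n^2*X*B + 55*A*G^3*n^2*X + 4*A*G^3*n*X^2*B^2 +
      11*A*G^3*n*X^2*B + 2*A*G^3*n*X^2 + 36*A*G^2*n^4*B^2 + 252*A*G^2*n^4*B + 292*A*G^2*n^4 +
      68*A*G^2*n^3*X*B^2 + 286*A*G^2*n^3*X*B + 164*A*G^2*n^3*X + 36*A*G^2*n^2*X^2*B^2 +
      74*A*G^2*n^2*X^2*B + 14*A*G^2*n^2*X^2 + 4*A*G^2*n*X^3*B^2 + A*G^2*n*X^3*B + 96*A*G*n^5*B^2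
      + 392*A*G*n^5*B + 248*A*G*n^5 + 168*A*G*n^4*X*B^2 + 444*A*G*n^4*X*B + 164*A*G*n^4*X +
      92*A*G*n^3*X^2*B^2 + 132*A*G*n^3*X^2*B + 20*A*G*n^3*X^2 + 16*A*G*n^2*X^3*B^2 +
      4*A*G*n^2*X^3*B + 80*A*n^6*B^2 + 208*A*n^6*B + 32*A*n^6 + 128*A*n^5*X*B^2 + 216*A*n^5*X*B
      + 16*A*n^5*X + 68*A*n^4*X^2*B^2 + 56*A*n^4*X^2*B + 12*A*n^3*X^3*B^2 + G^5*n^2 +
      4*G^4*n^3*B + 12*G^4*n^3 + 4*G^4*n^2*X*B + 4*G^4*n^2*X + 4*G^3*n^4*B^2 + 36*G^3*n^4*B +
      52*G^3*n^4 + 8*G^3*n^3*X*B^2 + 42*G^3*n^3*X*B + 30*G^3*n^3*X + 4*G^3*n^2*X^2*B^2 +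
      10*G^3*n^2*X^2*B + 3*G^3*n^2*X^2 + 24*G^2*n^5*B^2 + 112*G^2*n^5*B + 96*G^2*n^5 +
      44*G^2*n^4*X*B^2 + 136*G^2*n^4*X*B + 72*G^2*n^4*X + 24*G^2*n^3*X^2*B^2 + 44*G^2*n^3*X^2*B
      + 12*G^2*n^3*X^2 + 4*G^2*n^2*X^3*B^2 + 2*G^2*n^2*X^3*B + 48*G*n^6*B^2 + 144*G*n^6*B +
      64*G*n^6 + 80*G*n^5*X*B^2 + 168*G*n^5*X*B + 56*G*n^5*X + 44*G*n^4*X^2*B^2 + 56*G*n^4*X^2*B
      + 12*G*n^4*X^2 + 8*G*n^3*X^3*B^2 + 4*G*n^3*X^3*B + 32*n^7*B^2 + 64*n^7*B + 48*n^6*X*B^2 +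
      64*n^6*X*B + 24*n^5*X^2*B^2 + 16*n^5*X^2*B + 4*n^4*X^3*B^2)"
      unfolding E0_def lam_def m_def tau_def uG H_def xX by algebra
    also have "\<dots> > 0" using pos X G by (intro add_pos_nonneg nonneg) simp_all
    finally show ?thesis .
  qed
  have E1: "E1 \<ge> 0"
  proof -
    have "E1 = A^6 + 4*A^5*F + 9*A^5*n*B + 11*A^5*n + 3*A^5*X*B + 2*A^5*X + 6*A^4*F^2 + 27*A^4*F*n*B +
      35*A^4*F*n + 9*A^4*F*X*B + 6*A^4*F*X + 30*A^4*n^2*B^2 + 77*A^4*n^2*B + 48*A^4*n^2 +
      20*A^4*n*X*B^2 + 36*A^4*n*X*B + 16*A^4*n*X + 2*A^4*X^2*B^2 + 3*A^4*X^2*B + 4*A^3*F^3 +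
      27*A^3*F^2*n*B + 39*A^3*F^2*n + 9*A^3*F^2*X*B + 6*A^3*F^2*X + 60*A^3*F*n^2*B^2 +
      173*A^3*F*n^2*B + 117*A^3*F*n^2 + 40*A^3*F*n*X*B^2 + 81*A^3*F*n*X*B + 38*A^3*F*n*X +
      4*A^3*F*X^2*B^2 + 6*A^3*F*X^2*B + 44*A^3*n^3*B^3 + 188*A^3*n^3*B^2 + 248*A^3*n^3*B +
      104*A^3*n^3 + 44*A^3*n^2*X*B^3 + 149*A^3*n^2*X*B^2 + 146*A^3*n^2*X*B + 48*A^3*n^2*X +
      8*A^3*n*X^2*B^3 + 24*A^3*n*X^2*B^2 + 18*A^3*n*X^2*B + A^3*X^3*B^2 + A^2*F^4 +
      9*A^2*F^3*n*B + 17*A^2*F^3*n + 3*A^2*F^3*X*B + 2*A^2*F^3*X + 30*A^2*F^2*n^2*B^2 +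
      115*A^2*F^2*n^2*B + 91*A^2*F^2*n^2 + 20*A^2*F^2*n*X*B^2 + 54*A^2*F^2*n*X*B +
      28*A^2*F^2*n*X + 2*A^2*F^2*X^2*B^2 + 3*A^2*F^2*X^2*B + 44*A^2*F*n^3*B^3 +
      254*A^2*F*n^3*B^2 + 394*A^2*F*n^3*B + 184*A^2*F*n^3 + 44*A^2*F*n^2*X*B^3 +
      211*A^2*F*n^2*X*B^2 + 242*A^2*F*n^2*X*B + 85*A^2*F*n^2*X + 8*A^2*F*n*X^2*B^3 +
      32*A^2*F*n*X^2*B^2 + 30*A^2*F*n*X^2*B + A^2*F*X^3*B^2 + 24*A^2*n^4*B^4 + 184*A^2*n^4*B^3 +
      412*A^2*n^4*B^2 + 364*A^2*n^4*B + 112*A^2*n^4 + 32*A^2*n^3*X*B^4 + 222*A^2*n^3*X*B^3 +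
      390*A^2*n^3*X*B^2 + 254*A^2*n^3*X*B + 64*A^2*n^3*X + 8*A^2*n^2*X^2*B^4 +
      52*A^2*n^2*X^2*B^3 + 84*A^2*n^2*X^2*B^2 + 36*A^2*n^2*X^2*B + 2*A^2*n*X^3*B^3 +
      4*A^2*n*X^3*B^2 + 2*A*F^4*n + 19*A*F^3*n^2*B + 23*A*F^3*n^2 + 9*A*F^3*n*X*B + 6*A*F^3*n*X
      + 66*A*F^2*n^3*B^2 + 156*A*F^2*n^3*B + 90*A*F^2*n^3 + 62*A*F^2*n^2*X*B^2 +
      102*A*F^2*n^2*X*B + 41*A*F^2*n^2*X + 8*A*F^2*n*X^2*B^2 + 12*A*F^2*n*X^2*B +
      100*A*F*n^4*B^3 + 340*A*F*n^4*B^2 + 372*A*F*n^4*B + 132*A*F*n^4 + 140*A*F*n^3*X*B^3 +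
      364*A*F*n^3*X*B^2 + 288*A*F*n^3*X*B + 78*A*F*n^3*X + 32*A*F*n^2*X^2*B^3 +
      80*A*F*n^2*X^2*B^2 + 48*A*F*n^2*X^2*B + A*F*n^2*X^2 + 4*A*F*n*X^3*B^2 + 56*A*n^5*B^4 +
      240*A*n^5*B^3 + 360*A*n^5*B^2 + 224*A*n^5*B + 48*A*n^5 + 104*A*n^4*X*B^4 + 368*A*n^4*X*B^3
      + 416*A*n^4*X*B^2 + 180*A*n^4*X*B + 32*A*n^4*X + 32*A*n^3*X^2*B^4 + 112*A*n^3*X^2*B^3 +
      112*A*n^3*X^2*B^2 + 26*A*n^3*X^2*B + 8*A*n^2*X^3*B^3 + 4*A*n^2*X^3*B^2 + F^4*n^2 +
      10*F^3*n^3*B + 10*F^3*n^3 + 6*F^3*n^2*X*B + 4*F^3*n^2*X + 36*F^2*n^4*B^2 + 68*F^2*n^4*B +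
      32*F^2*n^4 + 44*F^2*n^3*X*B^2 + 60*F^2*n^3*X*B + 20*F^2*n^3*X + 8*F^2*n^2*X^2*B^2 +
      12*F^2*n^2*X^2*B + F^2*n^2*X^2 + 56*F*n^5*B^3 + 144*F*n^5*B^2 + 120*F*n^5*B + 32*F*n^5 +
      104*F*n^4*X*B^3 + 204*F*n^4*X*B^2 + 120*F*n^4*X*B + 24*F*n^4*X + 32*F*n^3*X^2*B^3 +
      64*F*n^3*X^2*B^2 + 28*F*n^3*X^2*B + 2*F*n^3*X^2 + 4*F*n^2*X^3*B^2 + 32*n^6*B^4 +
      96*n^6*B^3 + 96*n^6*B^2 + 32*n^6*B + 80*n^5*X*B^4 + 200*n^5*X*B^3 + 152*n^5*X*B^2 +
      32*n^5*X*B + 32*n^4*X^2*B^4 + 80*n^4*X^2*B^3 + 52*n^4*X^2*B^2 + 4*n^4*X^2*B +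
      8*n^3*X^3*B^3"
      unfolding E1_def psi_def rho_def lam_def m_def tau_def uG GF H_def xX by algebra
    also have "\<dots> \<ge> 0" using pos X F by (intro nonneg) simp_all
    finally show ?thesis .
  qed
  have E2: "E2 > 0"
  proof -
    have "E2 = A^6 + (4*A^5*F + 11*A^5*n*B + 11*A^5*n + 4*A^5*X*B + 2*A^5*X + 6*A^4*F^2 + 33*A^4*F*n*B +
      35*A^4*F*n + 12*A^4*F*X*B + 6*A^4*F*X + 42*A^4*n^2*B^2 + 93*A^4*n^2*B + 48*A^4*n^2 +
      28*A^4*n*X*B^2 + 44*A^4*n*X*B + 16*A^4*n*X + 3*A^4*X^2*B^2 + 3*A^4*X^2*B + 4*A^3*F^3 +
      33*A^3*F^2*n*B + 39*A^3*F^2*n + 12*A^3*F^2*X*B + 6*A^3*F^2*X + 84*A^3*F*n^2*B^2 +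
      211*A^3*F*n^2*B + 117*A^3*F*n^2 + 56*A^3*F*n*X*B^2 + 100*A^3*F*n*X*B + 38*A^3*F*n*X +
      6*A^3*F*X^2*B^2 + 6*A^3*F*X^2*B + 68*A^3*n^3*B^3 + 262*A^3*n^3*B^2 + 296*A^3*n^3*B +
      104*A^3*n^3 + 64*A^3*n^2*X*B^3 + 198*A^3*n^2*X*B^2 + 170*A^3*n^2*X*B + 48*A^3*n^2*X +
      12*A^3*n*X^2*B^3 + 30*A^3*n*X^2*B^2 + 18*A^3*n*X^2*B + A^3*X^3*B^2 + A^2*F^4 +
      11*A^2*F^3*n*B + 17*A^2*F^3*n + 4*A^2*F^3*X*B + 2*A^2*F^3*X + 42*A^2*F^2*n^2*B^2 +
      143*A^2*F^2*n^2*B + 91*A^2*F^2*n^2 + 28*A^2*F^2*n*X*B^2 + 68*A^2*F^2*n*X*B +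
      28*A^2*F^2*n*X + 3*A^2*F^2*X^2*B^2 + 3*A^2*F^2*X^2*B + 68*A^2*F*n^3*B^3 +
      364*A^2*F*n^3*B^2 + 478*A^2*F*n^3*B + 182*A^2*F*n^3 + 64*A^2*F*n^2*X*B^3 +
      286*A^2*F*n^2*X*B^2 + 284*A^2*F*n^2*X*B + 84*A^2*F*n^2*X + 12*A^2*F*n*X^2*B^3 +
      42*A^2*F*n*X^2*B^2 + 30*A^2*F*n*X^2*B + A^2*F*X^3*B^2 + 40*A^2*n^4*B^4 + 292*A^2*n^4*B^3 +
      568*A^2*n^4*B^2 + 424*A^2*n^4*B + 112*A^2*n^4 + 48*A^2*n^3*X*B^4 + 316*A^2*n^3*X*B^3 +
      492*A^2*n^3*X*B^2 + 284*A^2*n^3*X*B + 64*A^2*n^3*X + 12*A^2*n^2*X^2*B^4 +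
      72*A^2*n^2*X^2*B^3 + 96*A^2*n^2*X^2*B^2 + 36*A^2*n^2*X^2*B + 2*A^2*n*X^3*B^3 +
      4*A^2*n*X^3*B^2 + 2*A*F^4*n + 25*A*F^3*n^2*B + 23*A*F^3*n^2 + 12*A*F^3*n*X*B + 6*A*F^3*n*X
      + 102*A*F^2*n^3*B^2 + 196*A*F^2*n^3*B + 88*A*F^2*n^3 + 88*A*F^2*n^2*X*B^2 +
      122*A*F^2*n^2*X*B + 40*A*F^2*n^2*X + 12*A*F^2*n*X^2*B^2 + 12*A*F^2*n*X^2*B +
      172*A*F*n^4*B^3 + 492*A*F*n^4*B^2 + 436*A*F*n^4*B + 124*A*F*n^4 + 208*A*F*n^3*X*B^3 +
      472*A*F*n^3*X*B^2 + 320*A*F*n^3*X*B + 72*A*F*n^3*X + 48*A*F*n^2*X^2*B^3 +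
      96*A*F*n^2*X^2*B^2 + 48*A*F*n^2*X^2*B + 4*A*F*n*X^3*B^2 + 104*A*n^5*B^4 + 384*A*n^5*B^3 +
      472*A*n^5*B^2 + 240*A*n^5*B + 48*A*n^5 + 160*A*n^4*X*B^4 + 504*A*n^4*X*B^3 +
      488*A*n^4*X*B^2 + 184*A*n^4*X*B + 32*A*n^4*X + 48*A*n^3*X^2*B^4 + 144*A*n^3*X^2*B^3 +
      120*A*n^3*X^2*B^2 + 24*A*n^3*X^2*B + 8*A*n^2*X^3*B^3 + 4*A*n^2*X^3*B^2 + F^4*n^2 +
      14*F^3*n^3*B + 10*F^3*n^3 + 8*F^3*n^2*X*B + 4*F^3*n^2*X + 60*F^2*n^4*B^2 + 84*F^2*n^4*B +
      28*F^2*n^4 + 64*F^2*n^3*X*B^2 + 68*F^2*n^3*X*B + 16*F^2*n^3*X + 12*F^2*n^2*X^2*B^2 +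
      12*F^2*n^2*X^2*B + 104*F*n^5*B^3 + 200*F*n^5*B^2 + 120*F*n^5*B + 24*F*n^5 +
      160*F*n^4*X*B^3 + 248*F*n^4*X*B^2 + 112*F*n^4*X*B + 16*F*n^4*X + 48*F*n^3*X^2*B^3 +
      72*F*n^3*X^2*B^2 + 24*F*n^3*X^2*B + 4*F*n^2*X^3*B^2 + 64*n^6*B^4 + 144*n^6*B^3 +
      96*n^6*B^2 + 16*n^6*B + 128*n^5*X*B^4 + 256*n^5*X*B^3 + 144*n^5*X*B^2 + 16*n^5*X*B +
      48*n^4*X^2*B^4 + 96*n^4*X^2*B^3 + 48*n^4*X^2*B^2 + 8*n^3*X^3*B^3)"
      unfolding E2_def psi_def rho_def lam_def m_def tau_def uG GF H_def xX by algebra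
    also have "\<dots> > 0" using pos X F by (intro add_pos_nonneg nonneg) simp_all
    finally show ?thesis .
  qed
  have E3: "E3 \<ge> 0"
  proof -
    have "E3 = A^4 + 3*A^3*F + 6*A^3*n*B + 6*A^3*n + A^3*X*B + 3*A^2*F^2 + 12*A^2*F*n*B + 13*A^2*F*n +
      2*A^2*F*X*B + 12*A^2*n^2*B^2 + 25*A^2*n^2*B + 12*A^2*n^2 + 4*A^2*n*X*B^2 + 4*A^2*n*X*B +
      A*F^3 + 6*A*F^2*n*B + 8*A*F^2*n + A*F^2*X*B + 12*A*F*n^2*B^2 + 31*A*F*n^2*B + 16*A*F*n^2 +
      4*A*F*n*X*B^2 + 6*A*F*n*X*B + 8*A*n^3*B^3 + 30*A*n^3*B^2 + 28*A*n^3*B + 8*A*n^3 +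
      4*A*n^2*X*B^3 + 12*A*n^2*X*B^2 + 4*A*n^2*X*B + F^3*n + 6*F^2*n^2*B + 4*F^2*n^2 +
      2*F^2*n*X*B + 12*F*n^3*B^2 + 14*F*n^3*B + 4*F*n^3 + 8*F*n^2*X*B^2 + 4*F*n^2*X*B +
      8*n^4*B^3 + 12*n^4*B^2 + 4*n^4*B + 8*n^3*X*B^3 + 8*n^3*X*B^2"
      unfolding E3_def rho_def tau_def uG GF H_def by algebra
    also have "\<dots> \<ge> 0" using pos X F by (intro nonneg) simp_all
    finally show ?thesis .
  qed
  have Hn: "H - n > 0" using H pos by linarith
  have tau: "tau > 0"
  proof -
    have "tau = H * H + (H - n) * G + H * B * (n + X)" unfolding tau_def uG by algebra
    then show ?thesis using H Hn G pos X by (simp add: add_pos_nonneg)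
  qed
  have R1: "R\<^sub>1 = x\<^sup>2 * X * (H - n) + H * (n + X) * ((1 + B) * x * Z + B * Z\<^sup>2)"
    unfolding R\<^sub>1_def xX sZ H_def by algebra
  have R2: "R\<^sub>2 = x * tau + Z * (tau + n * G)"
    unfolding R\<^sub>2_def tau_def G_def[symmetric] xX sZ uG by algebra
  have L1: "L\<^sub>1 = X * lam + u * rho * Z"
    unfolding L\<^sub>1_def lam_def rho_def DX xX sZ H_def by algebra
  have L2: "L\<^sub>2 = m + H * B * u * Z"
    unfolding L\<^sub>2_def m_def tau_def G_def[symmetric] DX sZ by algebra
  have x0: "x > 0" using x pos by linarith
  show "0 < R\<^sub>1"
  proof (cases "X = 0")
    case True
    then have "Z > 0" using XZ by simp
    then show ?thesis unfolding R1 True using H pos x0 by (simp add: add_pos_pos)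
  next
    case False
    then have "x\<^sup>2 * X * (H - n) > 0" using X Hn x0 by simp
    moreover have "H * (n + X) * ((1 + B) * x * Z + B * Z\<^sup>2) \<ge> 0"
      using H pos X Z x0 by (intro mult_nonneg_nonneg add_nonneg_nonneg) auto
    ultimately show ?thesis unfolding R1 by linarith
  qed
  show "0 < R\<^sub>2" unfolding R2 using x0 tau Z G pos by (intro add_pos_nonneg) simp_all
  have "\<sigma> * (L\<^sub>1 * L\<^sub>2) - u\<^sup>2 * (R\<^sub>1 * R\<^sub>2) =
      \<sigma> * X * E0 + x * u * Z * E1 + u * Z\<^sup>2 * E2 + H * B * u * Z^3 * E3"
    unfolding L1 L2 R1 R2 E0_def E1_def E2_def E3_def psi_def sZ xX m_def by algebra
  also have "\<dots> > 0"
  proof -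
    \<comment> \<open>Strictness: \<open>X\<close> and \<open>Z\<close> are not both zero because \<open>2 * n < \<sigma>\<close>.\<close>
    have "\<sigma> * X * E0 + u * Z\<^sup>2 * E2 > 0"
    proof (cases "X = 0")
      case True
      then have "Z > 0" using XZ by simp
      then show ?thesis using True E2 u by simp
    next
      case False
      then have "\<sigma> * X * E0 > 0" using X E0 \<sigma> pos by (intro mult_pos_pos) auto
      moreover have "u * Z\<^sup>2 * E2 \<ge> 0" using u E2 by simp
      ultimately show ?thesis by linarith
    qed
    moreover have "x * u * Z * E1 \<ge> 0" "H * B * u * Z^3 * E3 \<ge> 0"
      using x0 u Z E1 E3 H pos by simp_all
    ultimately show ?thesis by linarith
  qed
  finally show "u\<^sup>2 * (R\<^sub>1 * R\<^sub>2) < \<sigma> * (L\<^sub>1 * L\<^sub>2)" by simp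
qed

text \<open>
  The number \<open>\<mu> = A - B * \<alpha> / \<beta>\<close> decides which parameters of the Lyapunov function
  work. For \<open>\<mu> \<ge> 0\<close> the ones of Lyness' recursion do, \<open>\<delta> = 0\<close> and \<open>a = \<alpha> / \<beta>\<close>. Then
  \<open>Q t = t * c t\<close> with a linear \<open>c\<close>, and \<open>key\<close> follows from
  \<open>x * (x + \<beta> + \<mu>) < D * (D + \<beta>)\<close>, where \<open>D = x + A + B * y\<close> exceeds
  \<open>x + \<mu>\<close>.
\<close>

lemma Lyapunov_function_low_threshold:
  fixes A B \<beta> \<mu> \<sigma> l h :: real
  defines "\<alpha> \<equiv> \<sigma> * (A - \<mu>)"
  defines "w \<equiv> \<lambda>y x. (\<alpha> + \<beta> * y) / (x + A + B * y)"
  assumes \<beta>: "\<beta> = B * \<sigma>" and pos: "0 < B" "0 \<le> \<mu>" "\<mu> < A" and lh: "0 < l" "l \<le> h" "h \<le> \<sigma>"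
  obtains W :: "real \<times> real \<Rightarrow> real"
  where "continuous_on ({l..h} \<times> {l..h}) W" "\<And>x y. W (x, y) = W (y, x)"
    "\<And>x y. y \<in> {l..h} \<Longrightarrow> x \<in> {l..h} \<Longrightarrow> w y x \<in> {l..h} \<Longrightarrow> w y x \<noteq> x \<Longrightarrow>
       W (y, w y x) < W (x, y)"
proof -
  have \<sigma>: "\<sigma> > 0" using lh by linarith
  have \<beta>0: "\<beta> > 0" using \<beta> \<sigma> pos by simp
  have A: "A > 0" using pos by linarith
  have \<alpha>: "\<alpha> > 0" using \<sigma> pos unfolding \<alpha>_def by simp
  define a where "a = (A - \<mu>) / B"
  have Ba: "B * a = A - \<mu>" using pos unfolding a_def by simp
  have \<beta>a: "\<beta> * a = \<alpha>" using Ba unfolding \<alpha>_def \<beta> by algebra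
  have a: "a > 0" using pos unfolding a_def by simp
  define c where "c = (\<lambda>t. t + B * (\<sigma> - t) + \<mu>)"
  have Q: "(t\<^sup>2 + A * t - \<alpha>) * (1 - 0 * t) + (\<beta> - B * t) * (a + t) = t * c t" for t
    using Ba \<beta>a \<beta> unfolding c_def by algebra
  have c: "c t > 0" if "t \<in> {l..h}" for t
    using that lh pos unfolding c_def by (auto intro!: add_pos_nonneg)
  have key: "(w y x)\<^sup>2 * (x * c x * (a + y + x - 0 * y * x)) <
      (x + A + B * y)\<^sup>2 * (w y x * c (w y x) * (a + y + w y x - 0 * y * w y x))"
    if y: "y \<in> {l..h}" and x: "x \<in> {l..h}" and wx: "w y x \<in> {l..h}" for y x
  proof -
    define E where "E = A + B * y"
    define D where "D = x + E"
    define v where "v = w y x"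
    define T where "T = E - \<mu> + B * x"
    have x0: "x > 0" and y0: "y > 0" and v0: "v > 0" using x y wx lh unfolding v_def by auto
    have "B * y > 0" using pos y0 by simp
    then have E: "E > \<mu>" "E > 0" unfolding E_def using pos by linarith+
    have T: "T > 0" unfolding T_def using E pos x0 by (intro add_pos_pos) auto
    have D0: "D > 0" using x0 E unfolding D_def by simp
    have vD: "v * D = \<sigma> * (E - \<mu>)"
    proof -
      have "v * D = \<alpha> + \<beta> * y"
        using D0 unfolding v_def w_def D_def E_def by (simp add: add.assoc)
      then show ?thesis unfolding \<alpha>_def \<beta> E_def by algebra
    qed
    have Va: "\<beta> * (a + y) = v * D" using vD \<beta>a unfolding \<beta> \<alpha>_def E_def by algebra
    have Dc: "D * c v = \<sigma> * T + B * \<sigma> * \<mu> + \<mu> * D"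
      using vD unfolding c_def T_def D_def by algebra
    have vx: "v * D + \<beta> * x = \<sigma> * T" using vD \<beta> unfolding T_def by algebra
    have cx: "c x \<le> x + \<beta> + \<mu>"
      using x0 pos unfolding c_def \<beta> by (simp add: algebra_simps)
    have "x * c x \<le> x * (x + \<beta> + \<mu>)" using cx x0 by simp
    also have "\<dots> < x * (D + \<beta>)" using x0 E unfolding D_def by simp
    also have "\<dots> < D * (D + \<beta>)" using E x0 \<beta>0 unfolding D_def by (intro mult_strict_right_mono) auto
    finally have "x * c x * (\<sigma> * T) < D * (D + \<beta>) * (\<sigma> * T)"
      using \<sigma> T by (intro mult_strict_right_mono) auto
    also have "\<dots> \<le> D * (D + \<beta>) * (D * c v)"
      unfolding Dc using D0 \<beta>0 \<sigma> pos by (intro mult_left_mono) auto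
    finally have 1: "x * c x * (v * D + \<beta> * x) < D * (D + \<beta>) * (D * c v)" unfolding vx .
    have "v\<^sup>2 * (x * c x * (v * D + \<beta> * x)) < v\<^sup>2 * (D * (D + \<beta>) * (D * c v))"
      using 1 v0 by (intro mult_strict_left_mono) auto
    moreover have "v\<^sup>2 * (x * c x * (v * D + \<beta> * x)) = \<beta> * (v\<^sup>2 * (x * c x * (a + y + x)))"
      using Va by algebra
    moreover have "v\<^sup>2 * (D * (D + \<beta>) * (D * c v)) = \<beta> * (D\<^sup>2 * (v * c v * (a + y + v)))"
      using Va by algebra
    ultimately have "\<beta> * (v\<^sup>2 * (x * c x * (a + y + x))) < \<beta> * (D\<^sup>2 * (v * c v * (a + y + v)))"
      by simp
    then show ?thesis using \<beta>0 unfolding v_def D_def E_def by (simp add: add.assoc)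
  qed
  show thesis
  proof (rule Lyapunov_function_if_key_inequality[of l h A B \<alpha> \<beta> a 0, unfolded Q])
    show "0 < t * c t" if "t \<in> {l..h}" for t using c[OF that] that lh by auto
    show "0 < a + y + t - 0 * y * t" if "y \<in> {l..h}" "t \<in> {l..h}" for y t
      using that a lh by auto
    fix W :: "real \<times> real \<Rightarrow> real"
    assume "continuous_on ({l..h} \<times> {l..h}) W" "\<And>x y. W (x, y) = W (y, x)"
      "\<And>x y. y \<in> {l..h} \<Longrightarrow> x \<in> {l..h} \<Longrightarrow> (\<alpha> + \<beta> * y) / (x + A + B * y) \<in> {l..h} \<Longrightarrow>
        (\<alpha> + \<beta> * y) / (x + A + B * y) \<noteq> x \<Longrightarrow> W (y, (\<alpha> + \<beta> * y) / (x + A + B * y)) < W (x, y)"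
    then show thesis by (rule that[unfolded w_def])
  qed (use lh pos A \<alpha> \<beta>0 key[unfolded w_def] in auto)
qed

text \<open>
  Here \<open>A - B * \<alpha> / \<beta> = - 2 * n\<close> is negative, and \<open>\<delta> = 0\<close> is not good enough in
  general. The parameters \<open>\<delta> = n / \<alpha>\<close> and \<open>a = \<alpha> / \<beta> - n\<close> compensate for it: near
  Lyness' recursion, that is to first order in \<open>A\<close> and \<open>B\<close>, the contribution \<open>- 2 * n\<close> to
  the difference of the two sides of \<open>key\<close> is cancelled by \<open>2 * \<delta> * \<alpha>\<close>, and what remains
  is positive. \<open>key_polynomial\<close> is the exact form of that computation.
\<close>

lemma Lyapunov_function_high_threshold:
  fixes A B \<beta> n \<sigma> l h :: real
  defines "\<alpha> \<equiv> \<sigma> * (A + 2 * n)"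
  defines "w \<equiv> \<lambda>y x. (\<alpha> + \<beta> * y) / (x + A + B * y)"
  assumes \<beta>: "\<beta> = B * \<sigma>" and pos: "0 < A" "0 < B" "0 < n"
    and lh: "2 * n \<le> l" "l \<le> h" "h \<le> \<sigma>" "2 * n < \<sigma>"
  obtains W :: "real \<times> real \<Rightarrow> real"
  where "continuous_on ({l..h} \<times> {l..h}) W" "\<And>x y. W (x, y) = W (y, x)"
    "\<And>x y. y \<in> {l..h} \<Longrightarrow> x \<in> {l..h} \<Longrightarrow> w y x \<in> {l..h} \<Longrightarrow> w y x \<noteq> x \<Longrightarrow>
       W (y, w y x) < W (x, y)"
proof -
  define H where "H = A + 2 * n"
  define \<delta> where "\<delta> = n / \<alpha>"
  define a where "a = \<alpha> / \<beta> - n"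
  have \<sigma>: "\<sigma> > 0" using lh pos by linarith
  have \<beta>0: "\<beta> > 0" using \<beta> \<sigma> pos by simp
  have H: "H > 2 * n" "H > 0" using pos unfolding H_def by simp_all
  have \<alpha>H: "\<alpha> = \<sigma> * H" unfolding \<alpha>_def H_def by simp
  have \<alpha>: "\<alpha> > 0" using \<sigma> H unfolding \<alpha>H by simp
  have \<delta>: "\<delta> * (\<sigma> * H) = n" using \<sigma> H unfolding \<delta>_def \<alpha>H by simp
  have \<beta>a: "\<beta> * a = \<alpha> - n * \<beta>" using \<beta>0 unfolding a_def by (simp add: right_diff_distrib)
  have Ba: "B * a = H - n * B"
    using pos \<sigma> unfolding a_def \<alpha>H \<beta> by (simp add: field_simps)
  define Q where "Q = (\<lambda>t. (t\<^sup>2 + A * t - \<alpha>) * (1 - \<delta> * t) + (\<beta> - B * t) * (a + t))"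
  define V where "V = (\<lambda>y t. a + y + t - \<delta> * y * t)"
  have Q: "\<sigma> * H * Q t = \<sigma> * H * (t - n) * (t + B * (\<sigma> - t)) - n * t\<^sup>2 * (t + A)" for t
  proof -
    have "Q t = t\<^sup>2 + A * t - \<alpha> - \<delta> * t\<^sup>2 * (t + A) + \<delta> * (\<sigma> * H) * t + \<beta> * a + \<beta> * t - B * a * t - B * t\<^sup>2"
      unfolding Q_def \<alpha>H by algebra
    also have "\<dots> = (t - n) * (t + B * (\<sigma> - t)) - \<delta> * t\<^sup>2 * (t + A)"
      unfolding \<delta> \<beta>a Ba unfolding H_def \<beta> by algebra
    finally have "\<sigma> * H * Q t =
        \<sigma> * H * (t - n) * (t + B * (\<sigma> - t)) - \<delta> * (\<sigma> * H) * t\<^sup>2 * (t + A)" by algebra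
    then show ?thesis unfolding \<delta> .
  qed
  have V: "H * \<beta> * V y t = H * (\<sigma> * (H + B * y) + B * \<sigma> * t - n * \<sigma> * B) - n * (B * y) * t" for y t
  proof -
    have "H * \<beta> * V y t = H * (\<beta> * a) + H * \<beta> * (y + t) - B * (\<delta> * (\<sigma> * H)) * y * t"
      unfolding V_def \<beta> by algebra
    then show ?thesis unfolding \<delta> \<beta>a unfolding \<alpha>H \<beta> by algebra
  qed
  have in_range: "2 * n \<le> t" "t \<le> \<sigma>" if "t \<in> {l..h}" for t using that lh by auto
  note poly = key_polynomial[OF pos in_range(1,2) in_range(1) lh(4), folded H_def]
  have Qpos: "Q t > 0" if "t \<in> {l..h}" for t
  proof -
    have "\<sigma> * H * Q t > 0" unfolding Q using poly(1)[OF that that that] .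
    then show ?thesis by (rule zero_less_mult_pos) (use \<sigma> H in simp)
  qed
  have Vpos: "V y t > 0" if "y \<in> {l..h}" "t \<in> {l..h}" for y t
  proof -
    have "H * \<beta> * V y t > 0" unfolding V using poly(2)[OF that(2) that(2) that(1)] .
    then show ?thesis by (rule zero_less_mult_pos) (use \<beta>0 H in simp)
  qed
  have one: "1 + a * \<delta> > 0"
  proof -
    have "n * n < \<sigma> * H" using lh(4) H pos by (intro mult_strict_mono) auto
    then have "n * \<delta> < 1" using \<alpha> unfolding \<delta>_def \<alpha>H by simp
    moreover have "a * \<delta> = n / \<beta> - n * \<delta>"
      using \<alpha> \<beta>0 unfolding a_def \<delta>_def by (simp add: field_simps)
    moreover have "n / \<beta> > 0" using pos \<beta>0 by simp
    ultimately show ?thesis by linarith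
  qed
  have key: "(w y x)\<^sup>2 * (Q x * V y x) < (x + A + B * y)\<^sup>2 * (Q (w y x) * V y (w y x))"
    if y: "y \<in> {l..h}" and x: "x \<in> {l..h}" and wx: "w y x \<in> {l..h}" for y x
  proof -
    define D where "D = x + A + B * y"
    define u where "u = H + B * y"
    define v where "v = w y x"
    have x0: "x > 0" and y0: "y > 0" using x y lh pos by auto
    have D0: "D > 0" using x0 y0 pos unfolding D_def by (simp add: add_pos_pos)
    have vD: "v * D = \<sigma> * u"
    proof -
      have "v * D = \<alpha> + \<beta> * y" using D0 unfolding v_def w_def D_def by simp
      then show ?thesis unfolding \<alpha>H \<beta> u_def by algebra
    qed
    define R\<^sub>1 where "R\<^sub>1 = \<sigma> * H * (x - n) * (x + B * (\<sigma> - x)) - n * x\<^sup>2 * (x + A)"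
    define R\<^sub>2 where "R\<^sub>2 = H * (\<sigma> * u + B * \<sigma> * x - n * \<sigma> * B) - n * (B * y) * x"
    define L\<^sub>1 where "L\<^sub>1 = H * (\<sigma> * u - n * D) * (u + B * (x - 2 * n)) * D - n * u\<^sup>2 * (\<sigma> * u + A * D)"
    define L\<^sub>2 where "L\<^sub>2 = H * (u * D + B * \<sigma> * u - n * B * D) - n * (B * y) * u"
    have less: "u\<^sup>2 * (R\<^sub>1 * R\<^sub>2) < \<sigma> * (L\<^sub>1 * L\<^sub>2)"
      unfolding R\<^sub>1_def R\<^sub>2_def L\<^sub>1_def L\<^sub>2_def u_def D_def by (rule poly(3)[OF x x y])
    have Qx: "\<sigma> * H * Q x = R\<^sub>1" unfolding Q R\<^sub>1_def ..
    have Vx: "H * \<beta> * V y x = R\<^sub>2" unfolding V R\<^sub>2_def u_def ..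
    have Qv: "\<sigma> * H * Q v * D^3 = \<sigma>\<^sup>2 * L\<^sub>1"
    proof -
      have "D = u + x - 2 * n" unfolding D_def u_def H_def by simp
      have "\<sigma> * H * Q v * D^3 = \<sigma> * H * (v * D - n * D) * (v * D + B * (\<sigma> * D - v * D)) * D -
          n * (v * D)\<^sup>2 * (v * D + A * D)"
        unfolding Q by algebra
      also have "\<dots> = \<sigma>\<^sup>2 * L\<^sub>1"
        unfolding vD L\<^sub>1_def using \<open>D = u + x - 2 * n\<close> by algebra
      finally show ?thesis .
    qed
    have Vv: "H * \<beta> * V y v * D = \<sigma> * L\<^sub>2"
    proof -
      have "H * \<beta> * V y v * D = H * (\<sigma> * u * D + B * \<sigma> * (v * D) - n * \<sigma> * B * D) - n * (B * y) * (v * D)"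
        unfolding V u_def by algebra
      then show ?thesis unfolding vD L\<^sub>2_def by algebra
    qed
    define k where "k = \<sigma> * H * (H * \<beta>) * D\<^sup>2"
    have k: "k > 0" using \<sigma> H \<beta>0 D0 unfolding k_def by simp
    have "k * (v\<^sup>2 * (Q x * V y x)) = (v * D)\<^sup>2 * ((\<sigma> * H * Q x) * (H * \<beta> * V y x))"
      unfolding k_def by algebra
    also have "\<dots> = \<sigma>\<^sup>2 * (u\<^sup>2 * (R\<^sub>1 * R\<^sub>2))" unfolding vD Qx Vx by algebra
    also have "\<dots> < \<sigma>\<^sup>2 * (\<sigma> * (L\<^sub>1 * L\<^sub>2))" using less \<sigma> by simp
    also have "\<dots> = (\<sigma> * H * Q v * D^3) * (H * \<beta> * V y v * D)" unfolding Qv Vv by algebra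
    also have "\<dots> = k * (D\<^sup>2 * (Q v * V y v))" unfolding k_def by algebra
    finally show ?thesis using k unfolding v_def D_def by simp
  qed
  show thesis
  proof (rule Lyapunov_function_if_key_inequality[of l h A B \<alpha> \<beta> a \<delta>])
    fix W :: "real \<times> real \<Rightarrow> real"
    assume "continuous_on ({l..h} \<times> {l..h}) W" "\<And>x y. W (x, y) = W (y, x)"
      "\<And>x y. y \<in> {l..h} \<Longrightarrow> x \<in> {l..h} \<Longrightarrow> (\<alpha> + \<beta> * y) / (x + A + B * y) \<in> {l..h} \<Longrightarrow>
        (\<alpha> + \<beta> * y) / (x + A + B * y) \<noteq> x \<Longrightarrow> W (y, (\<alpha> + \<beta> * y) / (x + A + B * y)) < W (x, y)"
    then show thesis by (rule that[unfolded w_def])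
  qed (use lh pos \<alpha> \<beta>0 one Qpos[unfolded Q_def] Vpos[unfolded V_def] key[unfolded w_def Q_def V_def] in auto)
qed

section \<open>The map of the recursion\<close>

definition rmap :: "real \<Rightarrow> real \<Rightarrow> real \<Rightarrow> real \<Rightarrow> real \<Rightarrow> real" where
  "rmap p q r u v = (r + p * u + v) / (q * u + v)"

locale positive_params =
  fixes p q r :: real
  assumes pqr: "0 < p" "0 < q" "0 < r"
begin

abbreviation f where "f \<equiv> rmap p q r"

lemma denom_pos: "0 < u \<Longrightarrow> 0 < v \<Longrightarrow> 0 < q * u + v"
  using pqr by (simp add: add_pos_pos)

lemma f_le_iff: "0 < u \<Longrightarrow> 0 < v \<Longrightarrow> f u v \<le> t \<longleftrightarrow> r + p * u + v \<le> t * (q * u + v)"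
  unfolding rmap_def by (rule pos_divide_le_eq[OF denom_pos])

lemma le_f_iff: "0 < u \<Longrightarrow> 0 < v \<Longrightarrow> t \<le> f u v \<longleftrightarrow> t * (q * u + v) \<le> r + p * u + v"
  unfolding rmap_def by (rule pos_le_divide_eq[OF denom_pos])

text \<open>
  The two constants \<open>1\<close> and \<open>p / q\<close> are tied to the monotonicity of \<open>f\<close>. The sign of
  \<open>(q - p) * u - r\<close> decides both whether \<open>f u v\<close> is below \<open>1\<close> and whether \<open>f\<close>
  increases in \<open>v\<close>. The sign of \<open>(p - q) * v - q * r\<close> decides both whether \<open>f u v\<close>
  is below \<open>p / q\<close> and whether \<open>f\<close> increases in \<open>u\<close>. This is why the position of the limit
  set relative to these constants determines the monotonicity of \<open>f\<close> on it.
\<close>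

lemma f_le_1_iff: "0 < u \<Longrightarrow> 0 < v \<Longrightarrow> f u v \<le> 1 \<longleftrightarrow> r \<le> (q - p) * u"
  by (simp add: f_le_iff algebra_simps)

lemma one_le_f_iff: "0 < u \<Longrightarrow> 0 < v \<Longrightarrow> 1 \<le> f u v \<longleftrightarrow> (q - p) * u \<le> r"
  by (simp add: le_f_iff algebra_simps)

lemma f_le_ratio_iff:
  assumes "0 < u" "0 < v"
  shows "q * f u v \<le> p \<longleftrightarrow> q * r \<le> (p - q) * v"
proof -
  have "q * f u v \<le> p \<longleftrightarrow> f u v \<le> p / q" using pqr by (simp add: field_simps)
  also have "\<dots> \<longleftrightarrow> q * (r + p * u + v) \<le> p * (q * u + v)"
    unfolding f_le_iff[OF assms] using pqr by (simp add: field_simps)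
  also have "\<dots> \<longleftrightarrow> q * r \<le> (p - q) * v" by (simp add: algebra_simps)
  finally show ?thesis .
qed

lemma f_cross: "0 < u \<Longrightarrow> 0 < v \<Longrightarrow> 0 < u' \<Longrightarrow> 0 < v' \<Longrightarrow>
    f u v \<le> f u' v' \<longleftrightarrow> (r + p * u + v) * (q * u' + v') \<le> (r + p * u' + v') * (q * u + v)"
  unfolding rmap_def using denom_pos[of u v] denom_pos[of u' v'] by (simp add: divide_simps mult.commute)

lemma f_antimono_right:
  assumes "0 < u" "0 < v" "v \<le> v'" "(q - p) * u \<le> r"
  shows "f u v' \<le> f u v"
proof -
  have "0 \<le> (v' - v) * (r - (q - p) * u)" using assms by simp
  then show ?thesis using assms by (simp add: f_cross algebra_simps)
qed

lemma f_mono_right: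
  assumes "0 < u" "0 < v" "v \<le> v'" "r \<le> (q - p) * u"
  shows "f u v \<le> f u v'"
proof -
  have "0 \<le> (v' - v) * ((q - p) * u - r)" using assms by simp
  then show ?thesis using assms by (simp add: f_cross algebra_simps)
qed

lemma f_antimono_left:
  assumes "0 < u" "0 < v" "u \<le> u'" "(p - q) * v \<le> q * r"
  shows "f u' v \<le> f u v"
proof -
  have "0 \<le> (u' - u) * (q * r - (p - q) * v)" using assms by simp
  then show ?thesis using assms by (simp add: f_cross algebra_simps)
qed

lemma f_mono_left:
  assumes "0 < u" "0 < v" "u \<le> u'" "q * r \<le> (p - q) * v"
  shows "f u v \<le> f u' v"
proof -
  have "0 \<le> (u' - u) * ((p - q) * v - q * r)" using assms by simp
  then show ?thesis using assms by (simp add: f_cross algebra_simps)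
qed

text \<open>
  If \<open>m\<close> and \<open>M\<close> are the extreme limit values, then evaluating the monotone map at the worst
  corners of \<open>{m..M}\<close> bounds \<open>M\<close> from above and \<open>m\<close> from below. If \<open>f\<close> decreases in both
  arguments where \<open>M\<close> is attained, then \<open>m = M\<close> follows for each of the three types of
  monotonicity that can occur where \<open>m\<close> is attained. Not covered are maps that decrease in \<open>u\<close>
  and increase in \<open>v\<close> throughout, which may have solutions of period two, and maps that
  increase in \<open>u\<close> and decrease in \<open>v\<close> throughout, for which the Lyapunov function takes over.
\<close>

lemma box_collapse_antimono_antimono:
  assumes "0 < m" "m \<le> M" "M \<le> f m m" "f M M \<le> m"
  shows "m = M"
proof -
  have "M * (q * m + m) \<le> r + p * m + m" "r + p * M + M \<le> m * (q * M + M)"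
    using assms by (simp_all add: f_le_iff le_f_iff)
  then have "(p + 1) * (M - m) \<le> 0" by (simp add: algebra_simps)
  then show ?thesis using assms pqr by (simp add: mult_le_0_iff)
qed

lemma box_collapse_antimono_mixed:
  assumes "0 < m" "m \<le> M" "M \<le> f m m" "f m M \<le> m"
  shows "m = M"
proof -
  have "M * (q * m + m) \<le> r + p * m + m" "r + p * m + M \<le> m * (q * m + M)"
    using assms by (simp_all add: f_le_iff le_f_iff)
  then have "(q * m + 1) * (M - m) \<le> 0" by (simp add: algebra_simps)
  moreover have "q * m + 1 > 0" using assms pqr by (simp add: add_pos_pos)
  ultimately show ?thesis using assms by (simp add: mult_le_0_iff)
qed

lemma box_collapse_mixed_antimono:
  assumes "0 < m" "m \<le> M" "M \<le> f m m" "f M m \<le> m"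
  shows "m = M"
proof -
  have "M * (q * m + m) \<le> r + p * m + m" "r + p * M + m \<le> m * (q * M + m)"
    using assms by (simp_all add: f_le_iff le_f_iff)
  then have "(m + p) * (M - m) \<le> 0" by (simp add: algebra_simps)
  then show ?thesis using assms pqr by (simp add: mult_le_0_iff)
qed

lemma eq_f_iff: "0 < u \<Longrightarrow> 0 < v \<Longrightarrow> f u v = t \<longleftrightarrow> r + p * u + v = t * (q * u + v)"
  unfolding rmap_def using denom_pos[of u v] by (simp add: divide_eq_eq)

lemma fixed_point_eq_equilibrium:
  assumes "0 < e" "f e e = e"
  shows "e = equilibrium p q r"
proof -
  have "is_equilibrium p q r e"
    using assms unfolding is_equilibrium_def is_solution_def rmap_def by simp
  then show ?thesis
    unfolding equilibrium_def using ex1_equilibrium[OF pqr] by (metis the_equality)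
qed

text \<open>
  In the coordinates \<open>x - 1, y - 1\<close> the numerator no longer contains the older argument,
  and \<open>f\<close> becomes the map \<open>w\<close> of the preceding section, with \<open>A = 1 + q\<close>, \<open>B = q\<close> and
  \<open>\<beta> = p - q\<close>. The upper end \<open>p / q\<close> becomes \<open>\<sigma>\<close>, and the threshold
  \<open>v = q * r / (p - q)\<close>, from which on \<open>f\<close> increases in its first argument, gives
  \<open>A - B * \<alpha> / \<beta> = 1 - v\<close>.
\<close>

lemma Lyapunov_function_f:
  assumes qp: "q < p" and mM: "1 < m" "m < M" "q * M \<le> p" "q * r \<le> (p - q) * m"
  obtains W :: "real \<times> real \<Rightarrow> real"
  where "continuous_on ({m..M} \<times> {m..M}) W" "\<And>x y. W (x, y) = W (y, x)"
    "\<And>x y. y \<in> {m..M} \<Longrightarrow> x \<in> {m..M} \<Longrightarrow> f y x \<in> {m..M} \<Longrightarrow> f y x \<noteq> x \<Longrightarrow>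
       W (y, f y x) < W (x, y)"
proof -
  define \<sigma> where "\<sigma> = (p - q) / q"
  define v where "v = q * r / (p - q)"
  have \<sigma>: "p - q = q * \<sigma>" using pqr unfolding \<sigma>_def by simp
  have v: "0 < v" "v \<le> m" "\<sigma> * v = r"
    using pqr qp mM unfolding v_def \<sigma>_def by (simp_all add: field_simps)
  have M\<sigma>: "M - 1 \<le> \<sigma>" using mM pqr unfolding \<sigma>_def by (simp add: field_simps)
  let ?w = "\<lambda>y x. (\<sigma> * (q + v) + (p - q) * y) / (x + (1 + q) + q * y)"
  have shift: "f y x - 1 = ?w (y - 1) (x - 1)" if "y \<in> {m..M}" "x \<in> {m..M}" for y x
  proof -
    have "0 < q * y + x" using denom_pos that mM by simp
    then have "f y x - 1 = (r + (p - q) * y) / (q * y + x)"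
      unfolding rmap_def by (simp add: field_simps)
    also have "r + (p - q) * y = \<sigma> * (q + v) + (p - q) * (y - 1)" using \<sigma> v by algebra
    finally show ?thesis by (simp add: algebra_simps)
  qed
  obtain W :: "real \<times> real \<Rightarrow> real"
    where W: "continuous_on ({m - 1..M - 1} \<times> {m - 1..M - 1}) W" "\<And>x y. W (x, y) = W (y, x)"
      "\<And>x y. y \<in> {m - 1..M - 1} \<Longrightarrow> x \<in> {m - 1..M - 1} \<Longrightarrow> ?w y x \<in> {m - 1..M - 1} \<Longrightarrow>
         ?w y x \<noteq> x \<Longrightarrow> W (y, ?w y x) < W (x, y)"
  proof (cases "v \<le> 1")
    case True
    show thesis
      by (rule Lyapunov_function_low_threshold[of "p - q" q \<sigma> "1 - v" "1 + q" "m - 1" "M - 1"])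
        (use that True v \<sigma> pqr mM M\<sigma> in auto)
  next
    case False
    have eq: "1 + q + 2 * ((v - 1) / 2) = q + v" by (simp add: field_simps)
    show thesis
      by (rule Lyapunov_function_high_threshold[of "p - q" q \<sigma> "1 + q" "(v - 1) / 2" "m - 1" "M - 1", unfolded eq])
        (use that False v \<sigma> pqr mM M\<sigma> in auto)
  qed
  define W' where "W' = (\<lambda>z. W (fst z - 1, snd z - 1))"
  have "continuous_on ({m..M} \<times> {m..M}) W'"
    unfolding W'_def by (intro continuous_on_compose2[OF W(1)] continuous_intros) auto
  moreover have "W' (x, y) = W' (y, x)" for x y unfolding W'_def by (simp add: W(2))
  moreover have "W' (y, f y x) < W' (x, y)"
    if "y \<in> {m..M}" "x \<in> {m..M}" "f y x \<in> {m..M}" "f y x \<noteq> x" for x y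
    using W(3)[of "y - 1" "x - 1"] that unfolding W'_def shift[OF that(1,2), symmetric] by simp
  ultimately show thesis by (intro that[of W'])
qed

lemma no_period_two_above:
  assumes "1 < x" "1 < z" "f z x = x" "f x z = z"
  shows "x = z"
proof -
  have "r + p * z + x = x * (q * z + x)" "r + p * x + z = z * (q * x + z)"
    using assms by (simp_all add: eq_f_iff)
  then have "(x - z) * (x + z + p - 1) = 0" by algebra
  then show ?thesis using assms pqr by auto
qed

end

section \<open>Convergence for p greater than q\<close>

locale bounded_solution = positive_params +
  fixes c C :: real and y :: "nat \<Rightarrow> real"
  assumes c: "0 < c" and y_range: "y n \<in> {c..C}"
    and y_rec: "y (Suc (Suc n)) = rmap p q r (y (Suc n)) (y n)"
begin

sublocale bounded_orbit "rmap p q r" c C y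
proof
  have "q * u + v \<noteq> 0" if "u \<in> {c..C}" "v \<in> {c..C}" for u v
    using denom_pos[of u v] that c by auto
  then show "continuous_on ({c..C} \<times> {c..C}) (\<lambda>(u, v). f u v)"
    unfolding rmap_def case_prod_beta by (intro continuous_intros) auto
qed (rule y_range y_rec)+

text \<open>
  Unless the limit set is a point, it lies where \<open>f\<close> increases in its first argument: a limit
  value above \<open>p / q\<close> would lead to one of the collapsing corner combinations, and values up
  to \<open>p / q\<close> are attained only from \<open>v\<close> beyond the threshold. All values of \<open>f\<close> exceed \<open>1\<close>
  here, so the Lyapunov function is available on the whole limit set.
\<close>

lemma converges_if_less:
  assumes qp: "q < p"
  shows "\<exists>e. y \<longlonglongrightarrow> e"
proof -
  obtain m M where mM: "limit_pairs y \<subseteq> {m..M} \<times> {m..M}" "m \<le> M" "c \<le> m"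
      "m \<in> fst ` limit_pairs y" "M \<in> fst ` limit_pairs y"
    by (rule limit_pairs_extremes)
  have m0: "0 < m" using mM c by simp
  show ?thesis
  proof (cases "m = M")
    case True
    then show ?thesis using tendsto_of_limit_pairs[of m] mM by auto
  next
    case False
    then have less: "m < M" using mM by simp
    obtain u0 v0 where 0: "(v0, u0) \<in> limit_pairs y" "m = f u0 v0" by (rule limit_value_pre[OF mM(4)])
    obtain u1 v1 where 1: "(v1, u1) \<in> limit_pairs y" "M = f u1 v1" by (rule limit_value_pre[OF mM(5)])
    have u0: "m \<le> u0" "u0 \<le> M" "0 < u0" and v0: "m \<le> v0" "v0 \<le> M" "0 < v0"
      using 0 mM m0 by auto
    have u1: "m \<le> u1" "0 < u1" and v1: "m \<le> v1" "0 < v1"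
      using 1 mM m0 by auto
    have dec: "(q - p) * u \<le> r" if "0 < u" for u
    proof -
      have "(q - p) * u \<le> 0" using qp that by (simp add: mult_le_0_iff)
      then show ?thesis using pqr by linarith
    qed
    have qM: "q * M \<le> p"
    proof (rule ccontr)
      assume "\<not> q * M \<le> p"
      then have "(p - q) * v1 \<le> q * r" using f_le_ratio_iff u1 v1 1 by auto
      then have "M \<le> f m v1" unfolding 1 using f_antimono_left m0 v1 u1 by blast
      also have "\<dots> \<le> f m m" using f_antimono_right m0 v1 dec by blast
      finally have Mm: "M \<le> f m m" .
      show False
      proof (cases "q * r \<le> (p - q) * v0")
        case True
        have "f m M \<le> f m v0" using f_antimono_right m0 v0 dec by blast
        also have "\<dots> \<le> m" unfolding 0(2) using f_mono_left[of m v0 u0] m0 u0 v0 True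
          unfolding 0(2)[symmetric] by blast
        finally show False using box_collapse_antimono_mixed[OF m0 mM(2) Mm] less by simp
      next
        case False
        have "f M M \<le> f M v0" using f_antimono_right[of M v0 M] m0 less v0 dec by auto
        also have "\<dots> \<le> m" using f_antimono_left[of u0 v0 M] u0 v0 False 0(2) by auto
        finally show False using box_collapse_antimono_antimono[OF m0 mM(2) Mm] less by simp
      qed
    qed
    have qm: "q * r \<le> (p - q) * m"
    proof -
      obtain z where z: "(m, z) \<in> limit_pairs y" using mM(4) by auto
      then have "f z m \<le> M" "0 < z" using limit_pairs_step[OF z] mM(1) m0 by auto
      moreover from this have "q * f z m \<le> q * M" using pqr by simp
      ultimately show ?thesis using f_le_ratio_iff[of z m] m0 qM by linarith
    qed
    have m1: "1 < m"
    proof -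
      have "(q - p) * u0 \<le> 0" using qp u0 by (simp add: mult_le_0_iff)
      then have "\<not> r \<le> (q - p) * u0" using pqr by linarith
      then show ?thesis using f_le_1_iff[OF u0(3) v0(3)] 0 by simp
    qed
    obtain W :: "real \<times> real \<Rightarrow> real"
      where W: "continuous_on ({m..M} \<times> {m..M}) W" "\<And>x y. W (x, y) = W (y, x)"
        "\<And>x y. y \<in> {m..M} \<Longrightarrow> x \<in> {m..M} \<Longrightarrow> f y x \<in> {m..M} \<Longrightarrow> f y x \<noteq> x \<Longrightarrow>
           W (y, f y x) < W (x, y)"
      using Lyapunov_function_f[OF qp m1 less qM qm] by blast
    have "limit_pairs y \<subseteq> {(equilibrium p q r, equilibrium p q r)}"
    proof (rule limit_pairs_Lyapunov)
      show "continuous_on (limit_pairs y) W" using W(1) mM(1) by (rule continuous_on_subset)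
      show "W (x, z) = W (z, x)" for x z by (rule W(2))
      show "W (z, f z x) < W (x, z)" if "(x, z) \<in> limit_pairs y" "f z x \<noteq> x" for x z
        using W(3) that limit_pairs_step[OF that(1)] mM(1) by blast
      show "(x, z) = (equilibrium p q r, equilibrium p q r)"
        if "(x, z) \<in> limit_pairs y" "f z x = x" "f x z = z" for x z
      proof -
        have 1: "1 < x" "1 < z" using that(1) mM(1) m1 by auto
        have "x = z" by (rule no_period_two_above[OF 1 that(2,3)])
        moreover from this have "x = equilibrium p q r"
          by (intro fixed_point_eq_equilibrium) (use 1 that in simp_all)
        ultimately show ?thesis by simp
      qed
    qed
    then show ?thesis using tendsto_of_limit_pairs by blast
  qed
qed

end

section \<open>Convergence of the two parity classes for p at most q\<close>

context bounded_solution
begin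

text \<open>
  The point \<open>U\<close> satisfies \<open>f U v = 1\<close> for all \<open>v\<close>. The interval \<open>{U..1}\<close> is invariant,
  and \<open>f\<close> decreases in its first and increases in its second argument there.
\<close>

lemma subsequences_converge_if_eventually_in:
  assumes U: "0 < U" "U < 1" "(q - p) * U = r" and N: "y N \<in> {U..1}" "y (Suc N) \<in> {U..1}"
  shows "\<exists>k a b. (\<lambda>j. y (k + 2 * j)) \<longlonglongrightarrow> a \<and> (\<lambda>j. y (Suc (k + 2 * j))) \<longlonglongrightarrow> b"
proof -
  have qp: "p < q" using U pqr by (metis diff_gt_0_iff_gt zero_less_mult_pos2)
  have thr: "r \<le> (q - p) * u" if "U \<le> u" for u
    using mult_left_mono[OF that, of "q - p"] U qp by simp
  have dec: "(p - q) * v \<le> q * r" if "0 < v" for v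
  proof -
    have "(p - q) * v \<le> 0" using qp that by (simp add: mult_le_0_iff)
    moreover have "0 < q * r" using pqr by simp
    ultimately show ?thesis by linarith
  qed
  have low: "U \<le> f 1 U"
  proof -
    have "0 \<le> (p + U) * (1 - U)" using U pqr by simp
    then show ?thesis using U by (simp add: le_f_iff algebra_simps)
  qed
  have inv: "f u v \<in> {U..1}" if "u \<in> {U..1}" "v \<in> {U..1}" for u v
  proof -
    have "f u v \<le> 1" using that U thr f_le_1_iff[of u v] by auto
    moreover have "f 1 U \<le> f 1 v" using f_mono_right[of 1 U v] thr[of 1] that U by auto
    moreover have "f 1 v \<le> f u v" using f_antimono_left[of u v 1] dec that U by auto
    ultimately show ?thesis using low by auto
  qed
  have range: "y (N + n) \<in> {U..1} \<and> y (Suc (N + n)) \<in> {U..1}" for n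
    by (induction n) (use N inv y_rec in auto)
  have "\<exists>k a b. (\<lambda>j. y (N + (k + 2 * j))) \<longlonglongrightarrow> a \<and> (\<lambda>j. y (N + Suc (k + 2 * j))) \<longlonglongrightarrow> b"
  proof (rule even_odd_subsequences_converge[of "\<lambda>n. y (N + n)" U 1 f])
    show "f u' v \<le> f u v" if "u \<in> {U..1}" "u' \<in> {U..1}" "v \<in> {U..1}" "u \<le> u'" for u u' v
      using f_antimono_left[of u v u'] dec that U by auto
    show "f u v \<le> f u v'" if "u \<in> {U..1}" "v \<in> {U..1}" "v' \<in> {U..1}" "v \<le> v'" for u v v'
      using f_mono_right[of u v v'] thr that U by auto
  qed (use range y_rec in auto)
  then obtain k a b where "(\<lambda>j. y (N + k + 2 * j)) \<longlonglongrightarrow> a" "(\<lambda>j. y (Suc (N + k + 2 * j))) \<longlonglongrightarrow> b"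
    by (auto simp: add.assoc)
  then show ?thesis by blast
qed

text \<open>
  A limit value above \<open>1\<close> forces the limit set to be a point. Otherwise all limit values lie
  in \<open>{U..1}\<close>. To conclude for the sequence itself, two consecutive terms in that interval are
  needed: if terms below \<open>U\<close> keep occurring, they accumulate only at \<open>U\<close>, and the three terms
  after them approach \<open>1\<close>, \<open>f 1 U\<close> and \<open>f (f 1 U) 1\<close>, the last two of which are interior
  points of the interval.
\<close>

lemma subsequences_converge_if_le:
  assumes pq: "p \<le> q"
  shows "\<exists>k a b. (\<lambda>j. y (k + 2 * j)) \<longlonglongrightarrow> a \<and> (\<lambda>j. y (Suc (k + 2 * j))) \<longlonglongrightarrow> b"
proof -
  obtain m M where mM: "limit_pairs y \<subseteq> {m..M} \<times> {m..M}" "m \<le> M" "c \<le> m"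
      "m \<in> fst ` limit_pairs y" "M \<in> fst ` limit_pairs y"
    by (rule limit_pairs_extremes)
  have m0: "0 < m" using mM c by simp
  show ?thesis
  proof (cases "m = M")
    case True
    then have "limit_pairs y \<subseteq> {(m, m)}" using mM by auto
    then have lim: "y \<longlonglongrightarrow> m" by (rule tendsto_of_limit_pairs)
    have "filterlim (\<lambda>j::nat. 2 * j) at_top sequentially" "filterlim (\<lambda>j::nat. Suc (2 * j)) at_top sequentially"
      by (auto intro!: filterlim_subseq strict_monoI)
    then have "(\<lambda>j. y (2 * j)) \<longlonglongrightarrow> m" "(\<lambda>j. y (Suc (2 * j))) \<longlonglongrightarrow> m"
      by (auto intro: filterlim_compose[OF lim])
    then show ?thesis by (intro exI[of _ 0] exI[of _ m]) simp
  next
    case False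
    then have less: "m < M" using mM by simp
    obtain u0 v0 where 0: "(v0, u0) \<in> limit_pairs y" "m = f u0 v0" by (rule limit_value_pre[OF mM(4)])
    obtain u1 v1 where 1: "(v1, u1) \<in> limit_pairs y" "M = f u1 v1" by (rule limit_value_pre[OF mM(5)])
    have u0: "u0 \<le> M" "0 < u0" and v0: "m \<le> v0" "v0 \<le> M" "0 < v0" using 0 mM m0 by auto
    have u1: "m \<le> u1" "0 < u1" and v1: "m \<le> v1" "0 < v1" using 1 mM m0 by auto
    have dec: "(p - q) * v \<le> q * r" if "0 < v" for v
    proof -
      have "(p - q) * v \<le> 0" using pq that by (simp add: mult_le_0_iff)
      moreover have "0 < q * r" using pqr by simp
      ultimately show ?thesis by linarith
    qed
    have M1: "M \<le> 1"
    proof (rule ccontr)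
      assume "\<not> M \<le> 1"
      then have "(q - p) * u1 \<le> r" using f_le_1_iff[OF u1(2) v1(2)] 1 by simp
      then have "M \<le> f u1 m" unfolding 1(2) using f_antimono_right m0 v1 u1 by blast
      also have "\<dots> \<le> f m m" using f_antimono_left m0 u1 dec by blast
      finally have Mm: "M \<le> f m m" .
      show False
      proof (cases "(q - p) * u0 \<le> r")
        case True
        have "f M M \<le> f u0 M" using f_antimono_left[of u0 M M] u0 m0 less dec by auto
        also have "\<dots> \<le> m" using f_antimono_right[of u0 v0 M] u0 v0 True 0(2) by auto
        finally show False using box_collapse_antimono_antimono[OF m0 mM(2) Mm] less by simp
      next
        case False
        have "f M m \<le> f u0 m" using f_antimono_left[of u0 m M] u0 m0 dec by auto
        also have "\<dots> \<le> m" using f_mono_right[of u0 m v0] u0 v0 m0 False 0(2) by auto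
        finally show False using box_collapse_mixed_antimono[OF m0 mM(2) Mm] less by simp
      qed
    qed
    have rm: "r \<le> (q - p) * m"
    proof -
      obtain z where "(m, z) \<in> limit_pairs y" using mM(4) by auto
      then obtain t where t: "(t, m) \<in> limit_pairs y" by (rule limit_pairs_pre)
      then have "f m t \<le> 1" "0 < t" using limit_pairs_step[OF t] mM(1) m0 M1 by auto
      then show ?thesis using f_le_1_iff m0 by blast
    qed
    then have qp: "p < q" using pqr pq m0 by (cases "p = q") auto
    define U where "U = r / (q - p)"
    have U: "0 < U" "(q - p) * U = r" using qp pqr unfolding U_def by simp_all
    have Um: "U \<le> m" using rm qp unfolding U_def by (simp add: divide_le_eq mult.commute)
    then have U1: "U < 1" using less M1 by linarith
    have gtU: "r < (q - p) * u" if "U < u" for u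
      using mult_strict_left_mono[OF that, of "q - p"] U qp by simp
    have "\<exists>N. y N \<in> {U..1} \<and> y (Suc N) \<in> {U..1}"
    proof (cases "\<forall>\<^sub>F n in sequentially. U \<le> y n")
      case True
      then obtain N where N: "\<And>n. N \<le> n \<Longrightarrow> U \<le> y n" unfolding eventually_sequentially by blast
      have "y (Suc (Suc n)) \<in> {U..1}" if "N \<le> n" for n
      proof -
        have "r \<le> (q - p) * y (Suc n)"
          using mult_left_mono[OF N[of "Suc n"], of "q - p"] that U qp by simp
        then have "f (y (Suc n)) (y n) \<le> 1"
          using f_le_1_iff[of "y (Suc n)" "y n"] y_range[of n] y_range[of "Suc n"] c by auto
        then show ?thesis using N[of "Suc (Suc n)"] that by (simp add: y_rec)
      qed
      from this[of N] this[of "Suc N"] show ?thesis by (intro exI[of _ "Suc (Suc N)"]) simp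
    next
      case False
      then have "\<forall>N. \<exists>n\<ge>N. y n < U" unfolding eventually_sequentially by (meson not_le)
      then obtain s where s: "\<And>k. k \<le> s k" "\<And>k. y (s k) < U" by metis
      have "filterlim s at_top sequentially"
        by (rule filterlim_at_top_mono[OF filterlim_ident]) (simp add: s)
      then obtain k l where l: "(\<lambda>i. (y (s (k i)), y (Suc (s (k i))))) \<longlonglongrightarrow> l" "l \<in> limit_pairs y"
        using convergent_subsequence by blast
      obtain x0 x1 where x: "l = (x0, x1)" by (cases l)
      have l0: "(\<lambda>i. y (s (k i))) \<longlonglongrightarrow> x0" and l1: "(\<lambda>i. y (Suc (s (k i)))) \<longlonglongrightarrow> x1"
        using tendsto_fst[OF l(1)] tendsto_snd[OF l(1)] unfolding x by simp_all
      have "x0 \<le> U" by (rule LIMSEQ_le_const2[OF l0]) (use s less_imp_le in blast)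
      moreover have "m \<le> x0" using l(2) mM(1) unfolding x by auto
      ultimately have x0: "x0 = U" using Um by simp
      obtain t where t: "(t, x0) \<in> limit_pairs y" "x1 = f x0 t"
        using l(2) unfolding x by (rule limit_pairs_pre)
      have t0: "0 < t" using t(1) mM(1) m0 by auto
      have x1: "x1 = 1" using t(2) f_le_1_iff[OF U(1) t0] one_le_f_iff[OF U(1) t0] U(2) unfolding x0 by simp
      have l2: "(\<lambda>i. y (Suc (Suc (s (k i))))) \<longlonglongrightarrow> f 1 U"
        unfolding y_rec using f_tendsto[OF l1 l0 y_range y_range] unfolding x0 x1 .
      have l3: "(\<lambda>i. y (Suc (Suc (Suc (s (k i)))))) \<longlonglongrightarrow> f (f 1 U) 1"
        unfolding y_rec[of "Suc n" for n] using f_tendsto[OF l2 l1 y_range y_range] unfolding x1 .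
      have x2: "U < f 1 U" "f 1 U < 1"
      proof -
        have "0 < (p + U) * (1 - U)" using U U1 pqr by simp
        then have "\<not> f 1 U \<le> U" using U U1 pqr by (simp add: f_le_iff algebra_simps)
        then show "U < f 1 U" by simp
        have "\<not> 1 \<le> f 1 U" using one_le_f_iff[of 1 U] gtU[of 1] U U1 by simp
        then show "f 1 U < 1" by simp
      qed
      have x3: "U < f (f 1 U) 1" "f (f 1 U) 1 < 1"
      proof -
        have "f 1 U \<le> f 1 1" using f_mono_right[of 1 U 1] gtU[of 1] U U1 by simp
        also have "f 1 1 \<le> f (f 1 U) 1" using f_antimono_left[of "f 1 U" 1 1] dec[of 1] x2 U by simp
        finally show "U < f (f 1 U) 1" using x2 by simp
        have "\<not> 1 \<le> f (f 1 U) 1" using one_le_f_iff[of "f 1 U" 1] gtU[of "f 1 U"] x2 U by simp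
        then show "f (f 1 U) 1 < 1" by simp
      qed
      have "\<forall>\<^sub>F i in sequentially. y (Suc (Suc (s (k i)))) \<in> {U<..<1} \<and> y (Suc (Suc (Suc (s (k i))))) \<in> {U<..<1}"
        using x2 x3
        by (intro eventually_conj topological_tendstoD[OF l2] topological_tendstoD[OF l3]) simp_all
      then obtain i where "y (Suc (Suc (s (k i)))) \<in> {U<..<1}" "y (Suc (Suc (Suc (s (k i))))) \<in> {U<..<1}"
        using eventually_happens'[OF sequentially_bot] by blast
      then show ?thesis by (intro exI[of _ "Suc (Suc (s (k i)))"]) auto
    qed
    then show ?thesis using subsequences_converge_if_eventually_in U U1 by blast
  qed
qed

end

section \<open>Solutions of the difference equation\<close>

lemma parity_limits_combine:
  fixes y :: "nat \<Rightarrow> real"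
  assumes a: "(\<lambda>j. y (K + 2 * j)) \<longlonglongrightarrow> a" and b: "(\<lambda>j. y (Suc (K + 2 * j))) \<longlonglongrightarrow> b"
  shows "(\<lambda>n. y n - (if even (n + K) then a else b)) \<longlonglongrightarrow> 0"
proof (rule LIMSEQ_I)
  fix \<epsilon> :: real assume "0 < \<epsilon>"
  then obtain J J' where J: "\<And>j. J \<le> j \<Longrightarrow> norm (y (K + 2 * j) - a) < \<epsilon>"
    and J': "\<And>j. J' \<le> j \<Longrightarrow> norm (y (Suc (K + 2 * j)) - b) < \<epsilon>"
    using LIMSEQ_D[OF a] LIMSEQ_D[OF b] by metis
  have "norm (y n - (if even (n + K) then a else b) - 0) < \<epsilon>" if n: "K + 2 * (J + J') + 1 \<le> n" for n
  proof (cases "even (n + K)")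
    case True
    then have "even (n - K)" using n by simp
    then obtain j where "n - K = 2 * j" by blast
    then have nj: "n = K + 2 * j" using n by linarith
    then have "J \<le> j" using n by presburger
    then show ?thesis using True J nj by simp
  next
    case False
    then have "odd (n - K)" using n by simp
    then obtain j where "n - K = 2 * j + 1" by (rule oddE)
    then have nj: "n = Suc (K + 2 * j)" using n by linarith
    then have "J' \<le> j" using n by presburger
    then show ?thesis using False J' nj by simp
  qed
  then show "\<exists>no. \<forall>n\<ge>no. norm (y n - (if even (n + K) then a else b) - 0) < \<epsilon>" by blast
qed

context positive_params
begin

text \<open>
  The lower bound holds after two steps for any positive initial values, because a mediant of
  \<open>p / q\<close> and \<open>1\<close> is only enlarged by \<open>r\<close>. The upper bound uses the lower one for the older
  of the two arguments, whence the shift by four.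
\<close>

lemma solution_eventually_bounded:
  assumes y: "is_solution p q r y"
  shows "\<exists>c C. bounded_solution p q r c C (\<lambda>n. y (n + 4))"
proof -
  have rec: "y (Suc (Suc n)) = f (y (Suc n)) (y n)" for n
    using y unfolding is_solution_def rmap_def by simp
  have pos: "0 < y n \<and> 0 < y (Suc n)" for n
  proof (induction n)
    case 0
    then show ?case using y unfolding is_solution_def by simp
  next
    case (Suc n)
    then show ?case using denom_pos pqr unfolding rec rmap_def by (simp add: add_pos_pos)
  qed
  define c where "c = min 1 (p / q)"
  define C where "C = max 1 (p / q) + r / c"
  have c: "0 < c" "c \<le> 1" "c * q \<le> p"
    using pqr unfolding c_def by (auto simp: min_def field_simps)
  have lower: "c \<le> f u v" if "0 < u" "0 < v" for u v
  proof -
    have "c * q * u \<le> p * u" "c * v \<le> 1 * v" using c that by (intro mult_right_mono; simp)+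
    moreover have "c * (q * u + v) = c * q * u + c * v" by algebra
    ultimately show ?thesis unfolding le_f_iff[OF that] using pqr by linarith
  qed
  have upper: "f u v \<le> C" if "0 < u" "c \<le> v" for u v
  proof -
    define k where "k = max 1 (p / q)"
    have k: "1 \<le> k" "p \<le> k * q" using pqr unfolding k_def by (auto simp: max_def field_simps)
    have v: "0 < v" using that c by linarith
    have "p * u \<le> k * q * u" "1 * v \<le> k * v" using k that v by (intro mult_right_mono; simp)+
    moreover have "r / c * c \<le> r / c * (q * u + v)"
      using that c pqr by (intro mult_left_mono) (auto intro: add_increasing)
    moreover have "r / c * c = r" using c by simp
    moreover have "C * (q * u + v) = k * q * u + k * v + r / c * (q * u + v)"
      unfolding C_def k_def[symmetric] by algebra
    ultimately show ?thesis unfolding f_le_iff[OF that(1) v] by linarith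
  qed
  have low: "c \<le> y (Suc (Suc n))" for n unfolding rec using lower pos by blast
  have "y (n + 4) \<in> {c..C}" for n
  proof -
    have "y (Suc (Suc (Suc (Suc n)))) \<le> C"
      unfolding rec[of "Suc (Suc n)"] using upper pos low by blast
    then show ?thesis using low[of "Suc (Suc n)"] by (simp add: numeral_eq_Suc)
  qed
  then have "bounded_solution p q r c C (\<lambda>n. y (n + 4))"
    using c rec[of "n + 4" for n] by unfold_locales simp_all
  then show ?thesis by blast
qed

end


theorem theorem4:
  fixes p q r :: real and y :: "nat \<Rightarrow> real"
  assumes "p > 0" and "q > 0" and "r > 0"
    and "is_solution p q r y"
  shows "y \<longlonglongrightarrow> equilibrium p q r \<or>
         (\<exists>u. is_prime_period_two_solution p q r u \<and> (\<lambda>n. y n - u n) \<longlonglongrightarrow> 0)"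
proof -
  interpret positive_params p q r using assms by unfold_locales
  obtain c C where "bounded_solution p q r c C (\<lambda>n. y (n + 4))"
    using solution_eventually_bounded[OF assms(4)] by blast
  then interpret Y: bounded_solution p q r c C "\<lambda>n. y (n + 4)" .
  have "\<exists>k a b. (\<lambda>j. y (k + 2 * j + 4)) \<longlonglongrightarrow> a \<and> (\<lambda>j. y (Suc (k + 2 * j) + 4)) \<longlonglongrightarrow> b"
  proof (cases "p \<le> q")
    case True
    then show ?thesis by (rule Y.subsequences_converge_if_le)
  next
    case False
    then obtain e where e: "(\<lambda>n. y (n + 4)) \<longlonglongrightarrow> e" using Y.converges_if_less by auto
    have "filterlim (\<lambda>j::nat. 0 + 2 * j) at_top sequentially"
      and "filterlim (\<lambda>j::nat. Suc (0 + 2 * j)) at_top sequentially"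
      by (auto intro!: filterlim_subseq strict_monoI)
    from filterlim_compose[OF e this(1)] filterlim_compose[OF e this(2)]
    have "(\<lambda>j. y (0 + 2 * j + 4)) \<longlonglongrightarrow> e" "(\<lambda>j. y (Suc (0 + 2 * j) + 4)) \<longlonglongrightarrow> e" .
    then show ?thesis by blast
  qed
  then obtain k a b where a: "(\<lambda>j. y (k + 2 * j + 4)) \<longlonglongrightarrow> a" and b: "(\<lambda>j. y (Suc (k + 2 * j) + 4)) \<longlonglongrightarrow> b"
    by blast
  define u where "u = (\<lambda>n::nat. if even (n + (k + 4)) then a else b)"
  have lim: "(\<lambda>n. y n - u n) \<longlonglongrightarrow> 0"
    unfolding u_def by (rule parity_limits_combine) (use a b in \<open>simp_all add: ac_simps\<close>)
  have "a \<in> {c..C}" "b \<in> {c..C}"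
    by (rule closed_sequentially[OF closed_atLeastAtMost _ a], rule Y.y_range)
      (rule closed_sequentially[OF closed_atLeastAtMost _ b], rule Y.y_range)
  then have pos: "0 < a" "0 < b" using Y.c by auto
  have "(\<lambda>j. f (y (Suc (k + 2 * j) + 4)) (y (k + 2 * j + 4))) \<longlonglongrightarrow> f b a"
    by (rule Y.f_tendsto[OF b a Y.y_range Y.y_range])
  then have "(\<lambda>j. y (k + 2 * Suc j + 4)) \<longlonglongrightarrow> f b a"
    unfolding Y.y_rec[symmetric] by simp
  then have fa: "f b a = a" using LIMSEQ_unique LIMSEQ_Suc[OF a] by blast
  have "(\<lambda>j. f (y (Suc (Suc (k + 2 * j)) + 4)) (y (Suc (k + 2 * j) + 4))) \<longlonglongrightarrow> f a b"
    using LIMSEQ_Suc[OF a] by (intro Y.f_tendsto[OF _ b Y.y_range Y.y_range]) simp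
  then have "(\<lambda>j. y (Suc (k + 2 * Suc j) + 4)) \<longlonglongrightarrow> f a b"
    unfolding Y.y_rec[symmetric] by simp
  then have fb: "f a b = b" using LIMSEQ_unique LIMSEQ_Suc[OF b] by blast
  show ?thesis
  proof (cases "a = b")
    case True
    then have "u = (\<lambda>n. a)" unfolding u_def by (simp add: fun_eq_iff)
    then have "y \<longlonglongrightarrow> a" using lim by (simp add: LIM_zero_iff)
    then show ?thesis using fixed_point_eq_equilibrium[OF pos(1)] fa True by simp
  next
    case False
    have "is_prime_period_two_solution p q r u"
      using pos fa fb False
      unfolding is_prime_period_two_solution_def is_solution_def rmap_def u_def by auto
    then show ?thesis using lim by blast
  qed
qed

end
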